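(* Let $\mu$ be a probability measure on the unit circle $S^1$ that is not concentrated in one point. Then $\mu$ can be embedded into a continuous monotone convolution semigroup if and only if $K_\mu'(z)\neq 0$ for all $z\in\mathbb{D}$ and there exists a locally uniform limit \[ \lim_{n\to\infty}-\frac{K_\mu^n(z)}{(K_\mu^n)'(z)}=v(z) \] in $\mathbb{D}$ that is of the form $v(z)=\alpha z u(z)$ with a non-zero constant $\alpha\in\mathbb{C}$ and a holomorphic function $u:\mathbb{D}\to\mathbb{C}$ such that $\mathrm{Re}\,u(z)\ge 0$ for all $z\in\mathbb{D}$ and $K_\mu'(0)=e^{-t_0u(0)}$ for some $t_0\ge 0$.
   Context: $\mathbb{D}=\{z\in\mathbb{C}:|z|<1\}$ and $S^1=\{z\in\mathbb{C}:|z|=1\}$. For a probability measure $\mu$ on $S^1$ define, for $z\in\mathbb{D}$, \[ \psi_\mu(z)=\int_{S^1}\frac{zx}{1-zx}\,d\mu(x),\qquad K_\mu(z)=\frac{\psi_\mu(z)}{1+\psi_\mu(z)}. \] $K_\mu$ is called the K-transform of $\mu$; it determines $\mu$, and a holomorphic function $K:\mathbb{D}\to\mathbb{D}$ is the K-transform of a probability measure on $S^1$ if and only if $K(0)=0$. $K_\mu^n$ denotes the $n$-fold composition $K_\mu\circ\cdots\circ K_\mu$, and $(K_\mu^n)'$ its derivative. The monotone convolution $\mu\triangleright\nu$ of two probability measures $\mu,\nu$ on $S^1$ is the unique probability measure on $S^1$ with $K_{\mu\triangleright\nu}=K_\mu\circ K_\nu$. A continuous monotone convolution semigroup is a weakly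 continuous family $(\mu_t)_{t\ge0}$ of probability measures on $S^1$ with $\mu_0=\delta_1$ (Dirac measure at $1$) and $\mu_s\triangleright\mu_t=\mu_{s+t}$ for all $s,t\ge0$. A probability measure $\mu$ can be embedded into a continuous monotone convolution semigroup if there exists such a semigroup $(\mu_t)_{t\ge0}$ with $\mu=\mu_t$ for some $t\ge0$. *)

theory Defs
  imports "HOL-Complex_Analysis.Complex_Analysis" "HOL-Probability.Probability"
begin

abbreviation unit_disc :: "complex set" where
  "unit_disc \<equiv> ball 0 1"

abbreviation unit_circle :: "complex set" where
  "unit_circle \<equiv> sphere 0 1"

definition circle_borel :: "complex measure" where
  "circle_borel = restrict_space borel unit_circle"

definition circle_prob :: "complex measure \<Rightarrow> bool" where
  "circle_prob \<mu> \<longleftrightarrow> prob_space \<mu> \<and> sets \<mu> = sets circle_borel"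

definition psi_transform :: "complex measure \<Rightarrow> complex \<Rightarrow> complex" where
  "psi_transform \<mu> z = (\<integral>x. z * x / (1 - z * x) \<partial>\<mu>)"

(* Only the values on the unit disc are meaningful, for this function and for K_transform. *)

definition K_transform :: "complex measure \<Rightarrow> complex \<Rightarrow> complex" where
  "K_transform \<mu> z = psi_transform \<mu> z / (1 + psi_transform \<mu> z)"

(* Existence and uniqueness of this measure, for circle_prob \<mu> and circle_prob \<nu>, follow from the
   facts that K-transforms determine measures and that the K-transforms are exactly the
   holomorphic self-maps of the unit disc fixing 0. *)

definition monotone_conv :: "complex measure \<Rightarrow> complex measure \<Rightarrow> complex measure"
    (infixl "\<rhd>" 70) where
  "\<mu> \<rhd> \<nu> = (THE \<rho>. circle_prob \<rho> \<and>
     (\<forall>z\<in>unit_disc. K_transform \<rho> z = K_transform \<mu> (K_transform \<nu> z)))"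

definition weakly_continuous_family :: "(real \<Rightarrow> complex measure) \<Rightarrow> bool" where
  "weakly_continuous_family M \<longleftrightarrow>
     (\<forall>f::complex \<Rightarrow> real. continuous_on unit_circle f \<longrightarrow>
        continuous_on {0..} (\<lambda>t. \<integral>x. f x \<partial>M t))"

(* Families are indexed by all of real; only the members with t >= 0 are constrained. *)

definition monotone_conv_semigroup :: "(real \<Rightarrow> complex measure) \<Rightarrow> bool" where
  "monotone_conv_semigroup M \<longleftrightarrow>
     (\<forall>t\<ge>0. circle_prob (M t)) \<and>
     weakly_continuous_family M \<and>
     M 0 = return circle_borel 1 \<and>
     (\<forall>s\<ge>0. \<forall>t\<ge>0. M s \<rhd> M t = M (s + t))"

definition embeddable :: "complex measure \<Rightarrow> bool" where
  "embeddable \<mu> \<longleftrightarrow> (\<exists>M. monotone_conv_semigroup M \<and> (\<exists>t\<ge>0. \<mu> = M t))"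

definition locally_uniform_limit ::
    "complex set \<Rightarrow> (nat \<Rightarrow> complex \<Rightarrow> complex) \<Rightarrow> (complex \<Rightarrow> complex) \<Rightarrow> bool" where
  "locally_uniform_limit S f g \<longleftrightarrow>
     (\<forall>z\<in>S. \<exists>r>0. ball z r \<subseteq> S \<and> uniform_limit (ball z r) f g sequentially)"

end

theory Submission
  imports Defs
begin

text \<open>If \<open>\<mu>\<close> is not concentrated in one point, \<open>K = K_transform \<mu>\<close> satisfies \<open>\<bar>K' 0\<bar> < 1\<close>, and when \<open>K' 0 \<noteq> 0\<close>
  there is a Koenigs function \<open>\<sigma>\<close>, the limit of \<open>K\<^sup>n / (K' 0) ^ n\<close>, with \<open>\<sigma> (K z) = K' 0 * \<sigma> z\<close>. Hence,
  for \<open>K'\<close> without zeros, the limit in the theorem always exists and equals \<open>- \<sigma> / \<sigma>'\<close>; only its form matters.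

  A semigroup containing \<open>\<mu>\<close> commutes with \<open>K\<close>, so \<open>\<sigma>\<close> linearizes all of it, \<open>\<sigma> (K\<^sub>s z) = exp (- a s) * \<sigma> z\<close>,
  and its generator at \<open>s = 0\<close> is \<open>- z * u z\<close> with \<open>u = a * \<sigma> / (z * \<sigma>')\<close>. Since \<open>\<bar>K\<^sub>s z\<bar> \<le> \<bar>z\<bar>\<close>, \<open>Re u \<ge> 0\<close>.

  Conversely, if \<open>Re u \<ge> 0\<close>, lifting the spirals \<open>exp (- a s) * \<sigma> z\<close> through the locally injective \<open>\<sigma>\<close> gives curves
  along which the modulus decreases. So they can be continued for all times and tend to \<open>0\<close>, which shows that
  \<open>\<sigma>\<close> is injective with spirallike range, and \<open>K\<^sub>s = \<sigma>\<^sup>-\<^sup>1 (exp (- a s) * \<sigma> z)\<close> defines the semigroup. Its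
  members are K-transforms by Herglotz' theorem, which follows from Helly's selection theorem.\<close>

section \<open>K-transforms of measures on the circle\<close>

text \<open>The limit determines only \<open>\<sigma> / \<sigma>'\<close>, hence \<open>u\<close>
  only up to a constant factor. The equation for \<open>K' 0\<close> ties this factor to a branch of
  the logarithm of \<open>K' 0\<close>; different branches give different spirals, and embedding
  means that \<open>Re u \<ge> 0\<close> holds for one of them. Comparison at \<open>0\<close>
  forces \<open>\<alpha> * u 0 = - 1\<close>, so that \<open>u 0\<close> is the rate
  \<open>a\<close> and \<open>t0\<close> the time at which the semigroup passes through \<mu>. The
  obstacle in the converse is that local inverses of \<open>\<sigma>\<close> have no common size. On
  a closed disc of radius \<open>R < 1\<close> compactness supplies one, and with it a common time
  step; as a step never increases the modulus, the orbit stays in that disc and the same step can be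
  repeated. Monotone convolution is defined by \<open>THE\<close>, so it can be used only once
  K-transforms are known to determine measures and to exhaust the self-maps of the disc fixing
  \<open>0\<close>. Weak continuity is reached through moments, which are recovered from the
  K-transform at fixed points uniformly over all measures.\<close>

lemma space_circle_prob: "circle_prob \<mu> \<Longrightarrow> space \<mu> = unit_circle"
  using sets_eq_imp_space_eq[of \<mu> circle_borel]
  by (simp add: circle_prob_def circle_borel_def space_restrict_space)

lemma borel_measurable_circle_prob:
  fixes f :: "complex \<Rightarrow> 'b::topological_space"
  assumes "circle_prob \<mu>" "continuous_on unit_circle f"
  shows "f \<in> borel_measurable \<mu>"
proof -
  have "f \<in> borel_measurable (restrict_space borel unit_circle)"
    by (rule borel_measurable_continuous_on_restrict) fact
  moreover have "sets \<mu> = sets (restrict_space borel unit_circle)"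
    using assms(1) by (simp add: circle_prob_def circle_borel_def)
  ultimately show ?thesis
    using measurable_cong_sets by blast
qed

lemma integrable_circle_prob:
  fixes f :: "complex \<Rightarrow> 'b::{banach, second_countable_topology}"
  assumes "circle_prob \<mu>" "continuous_on unit_circle f"
  shows "integrable \<mu> f"
proof -
  interpret prob_space \<mu> using assms(1) by (simp add: circle_prob_def)
  obtain B where B: "\<And>x. x \<in> unit_circle \<Longrightarrow> norm (f x) \<le> B"
    using compact_imp_bounded[OF compact_continuous_image[OF assms(2) compact_sphere]]
    unfolding bounded_iff by blast
  show ?thesis
    by (rule integrable_const_bound[where B = B])
       (use B space_circle_prob[OF assms(1)] borel_measurable_circle_prob[OF assms] in auto)
qed

lemma norm_integral_circle_prob_le:
  fixes f :: "complex \<Rightarrow> 'b::{banach, second_countable_topology}"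
  assumes "circle_prob \<mu>" "continuous_on unit_circle f"
    and "\<And>x. norm x = 1 \<Longrightarrow> norm (f x) \<le> B"
  shows "norm (\<integral>x. f x \<partial>\<mu>) \<le> B"
proof -
  interpret prob_space \<mu> using assms(1) by (simp add: circle_prob_def)
  have "norm (\<integral>x. f x \<partial>\<mu>) \<le> (\<integral>x. norm (f x) \<partial>\<mu>)"
    by (rule integral_norm_bound)
  also have "\<dots> \<le> (\<integral>x. B \<partial>\<mu>)"
    by (rule integral_mono)
       (use assms space_circle_prob[OF assms(1)] in
         \<open>auto intro!: integrable_norm integrable_circle_prob\<close>)
  finally show ?thesis by (simp add: prob_space)
qed

section \<open>Moments and the power series of \<open>psi_transform\<close>\<close>

definition circle_moment :: "complex measure \<Rightarrow> nat \<Rightarrow> complex" where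
  "circle_moment \<mu> n = (\<integral>x. x ^ n \<partial>\<mu>)"

lemma one_minus_mult_circle:
  fixes x z :: complex
  assumes "norm z < 1" "norm x = 1"
  shows "1 - norm z \<le> norm (1 - z * x)" "1 - z * x \<noteq> 0"
proof -
  have "norm (1::complex) - norm (z * x) \<le> norm (1 - z * x)"
    by (rule norm_triangle_ineq2)
  then show "1 - norm z \<le> norm (1 - z * x)"
    using assms by (simp add: norm_mult)
  then show "1 - z * x \<noteq> 0" using assms by auto
qed

lemma continuous_on_psi_kernel:
  "norm z < 1 \<Longrightarrow> continuous_on unit_circle (\<lambda>x. z * x / (1 - z * x))"
  by (intro continuous_intros) (use one_minus_mult_circle in auto)

text \<open>The geometric series of the kernel, integrated; its remainder is
  \<open>(z * x) ^ Suc n / (1 - z * x)\<close>. The bound is the same for all measures, which later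
  makes the recovery of moments uniform over a family.\<close>

lemma psi_transform_taylor:
  assumes \<mu>: "circle_prob \<mu>" and z: "norm z < 1"
  shows "norm (psi_transform \<mu> z - (\<Sum>k<n. circle_moment \<mu> (Suc k) * z ^ Suc k))
           \<le> norm z ^ Suc n / (1 - norm z)"
proof -
  have nz: "1 - z * x \<noteq> 0" if "norm x = 1" for x
    using one_minus_mult_circle[OF z that] by simp
  have int: "integrable \<mu> (\<lambda>x. (z * x) ^ Suc k)" for k
    by (rule integrable_circle_prob[OF \<mu>]) (intro continuous_intros)
  have "psi_transform \<mu> z - (\<Sum>k<n. circle_moment \<mu> (Suc k) * z ^ Suc k)
      = (\<integral>x. z * x / (1 - z * x) - (\<Sum>k<n. (z * x) ^ Suc k) \<partial>\<mu>)"
    unfolding psi_transform_def circle_moment_def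
    using int integrable_circle_prob[OF \<mu> continuous_on_psi_kernel[OF z]]
    by (subst Bochner_Integration.integral_diff)
       (simp_all add: Bochner_Integration.integral_sum power_mult_distrib mult.commute[of _ "z ^ _"]
             del: power_Suc)
  also have "norm \<dots> \<le> norm z ^ Suc n / (1 - norm z)"
  proof (rule norm_integral_circle_prob_le[OF \<mu>])
    show "continuous_on unit_circle (\<lambda>x. z * x / (1 - z * x) - (\<Sum>k<n. (z * x) ^ Suc k))"
      by (intro continuous_intros) (use nz in auto)
  next
    fix x :: complex assume x: "norm x = 1"
    have "(\<Sum>k<n. (z * x) ^ Suc k) = z * x * (\<Sum>k<n. (z * x) ^ k)"
      by (simp add: sum_distrib_left)
    also have "(\<Sum>k<n. (z * x) ^ k) = (1 - (z * x) ^ n) / (1 - z * x)"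
      using nz[OF x] by (subst sum_gp_strict) auto
    finally have "z * x / (1 - z * x) - (\<Sum>k<n. (z * x) ^ Suc k) = (z * x) ^ Suc n / (1 - z * x)"
      using nz[OF x] by (simp add: field_simps)
    moreover have "norm ((z * x) ^ Suc n / (1 - z * x)) \<le> norm z ^ Suc n / (1 - norm z)"
      using x z one_minus_mult_circle(1)[OF z x]
      by (simp add: norm_divide norm_mult norm_power frac_le mult_left_le del: power_Suc)
    ultimately show "norm (z * x / (1 - z * x) - (\<Sum>k<n. (z * x) ^ Suc k)) \<le> norm z ^ Suc n / (1 - norm z)"
      by simp
  qed
  finally show ?thesis .
qed

lemma psi_transform_sums:
  assumes \<mu>: "circle_prob \<mu>" and z: "norm z < 1"
  shows "(\<lambda>k. circle_moment \<mu> (Suc k) * z ^ Suc k) sums psi_transform \<mu> z"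
  unfolding sums_def
proof (rule Lim_transform2[OF tendsto_const])
  have "(\<lambda>n. norm z ^ Suc n / (1 - norm z)) \<longlonglongrightarrow> 0 / (1 - norm z)"
    by (intro tendsto_intros LIMSEQ_Suc[OF LIMSEQ_power_zero]) (use z in auto)
  then show "(\<lambda>n. psi_transform \<mu> z - (\<Sum>k<n. circle_moment \<mu> (Suc k) * z ^ Suc k)) \<longlonglongrightarrow> 0"
    using Lim_null_comparison[OF always_eventually[OF allI[OF psi_transform_taylor[OF \<mu> z]]]]
    by simp
qed

text \<open>Shifting the power series by one index divides out the zero at the origin. The factor
  yields both the holomorphy of \<open>psi_transform\<close> and the derivative of the K-transform
  at \<open>0\<close>.\<close>

lemma psi_transform_factor:
  assumes \<mu>: "circle_prob \<mu>"
  obtains h where "h holomorphic_on unit_disc" "h 0 = circle_moment \<mu> 1"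
    "\<And>z. z \<in> unit_disc \<Longrightarrow> psi_transform \<mu> z = z * h z"
proof -
  define h where "h z = (if z = 0 then circle_moment \<mu> 1 else psi_transform \<mu> z / z)" for z
  have "(\<lambda>k. circle_moment \<mu> (Suc k) * (z - 0) ^ k) sums h z" if "z \<in> unit_disc" for z
  proof (cases "z = 0")
    case True
    then show ?thesis
      using powser_sums_zero[of "\<lambda>k. circle_moment \<mu> (Suc k)"] by (simp add: h_def)
  next
    case False
    have "(\<lambda>k. circle_moment \<mu> (Suc k) * z ^ Suc k / z) sums (psi_transform \<mu> z / z)"
      using that by (intro sums_divide psi_transform_sums[OF \<mu>]) simp
    then show ?thesis using False by (simp add: h_def)
  qed
  then have "h holomorphic_on unit_disc" by (rule power_series_holomorphic)
  moreover have "psi_transform \<mu> z = z * h z" for z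
    by (simp add: h_def psi_transform_def)
  ultimately show ?thesis using that[of h] by (auto simp: h_def)
qed

lemma holomorphic_psi_transform:
  assumes "circle_prob \<mu>" shows "psi_transform \<mu> holomorphic_on unit_disc"
proof -
  obtain h where h: "h holomorphic_on unit_disc" "h 0 = circle_moment \<mu> 1"
    "\<And>z. z \<in> unit_disc \<Longrightarrow> psi_transform \<mu> z = z * h z"
    using psi_transform_factor[OF assms] by blast
  have "(\<lambda>z. z * h z) holomorphic_on unit_disc" by (intro holomorphic_intros h)
  then show ?thesis by (rule holomorphic_transform) (use h in auto)
qed

text \<open>With \<open>w = z * x\<close>, the kernel is half of \<open>(1 + w) / (1 - w)\<close>
  minus \<open>1 / 2\<close>, and the real part of that quotient is the Poisson kernel
  \<open>(1 - norm w ^ 2) / norm (1 - w) ^ 2\<close>. Estimating \<open>norm (1 - w)\<close> by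
  \<open>2\<close> leaves a margin independent of \<open>x\<close>, so the strict inequality
  survives integration.\<close>

lemma Re_psi_kernel_gt:
  fixes z x :: complex
  assumes z: "norm z < 1" and x: "norm x = 1"
  shows "Re (z * x / (1 - z * x)) \<ge> - 1 / 2 + (1 - norm z ^ 2) / 8"
proof -
  define w where "w = z * x"
  have nw: "norm w = norm z" using x by (simp add: w_def norm_mult)
  have nz: "1 - w \<noteq> 0" using one_minus_mult_circle[OF z x] by (simp add: w_def)
  have eq: "w / (1 - w) = - 1 / 2 + (1 + w) / (2 * (1 - w))"
    using nz by (simp add: field_simps)
  have "(1 + w) / (1 - w) = (1 + w) * cnj (1 - w) / of_real (norm (1 - w) ^ 2)"
    using complex_div_cnj[of "1 + w" "1 - w"] by simp
  then have "Re ((1 + w) / (1 - w)) = Re ((1 + w) * cnj (1 - w)) / norm (1 - w) ^ 2"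
    by (metis Re_divide_of_real)
  also have "Re ((1 + w) * cnj (1 - w)) = 1 - norm w ^ 2"
    by (simp add: cmod_power2) (simp add: algebra_simps power2_eq_square)
  finally have re: "Re ((1 + w) / (1 - w)) = (1 - norm w ^ 2) / norm (1 - w) ^ 2" .
  have "norm (1 - w) \<le> norm (1::complex) + norm w" by (rule norm_triangle_ineq4)
  then have "norm (1 - w) \<le> 2" using nw z by simp
  then have "norm (1 - w) ^ 2 \<le> 2 ^ 2" by (rule power_mono) simp
  moreover have "norm w ^ 2 \<le> 1" using nw z by (simp add: power_le_one)
  ultimately have "(1 - norm w ^ 2) / 4 \<le> (1 - norm w ^ 2) / norm (1 - w) ^ 2"
    using nz by (intro divide_left_mono) auto
  moreover have "Re (w / (1 - w)) = - 1 / 2 + Re ((1 + w) / (1 - w)) / 2"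
    unfolding eq using Re_divide_numeral[of "(1 + w) / (1 - w)" "num.Bit0 num.One"]
    by (simp add: mult.commute)
  ultimately have "Re (w / (1 - w)) \<ge> - 1 / 2 + (1 - norm w ^ 2) / 8" using re by linarith
  then show ?thesis using nw by (simp add: w_def)
qed

lemma Re_psi_transform_gt:
  assumes \<mu>: "circle_prob \<mu>" and z: "norm z < 1"
  shows "Re (psi_transform \<mu> z) > - 1 / 2"
proof -
  interpret prob_space \<mu> using \<mu> by (simp add: circle_prob_def)
  have int: "integrable \<mu> (\<lambda>x. z * x / (1 - z * x))"
    by (rule integrable_circle_prob[OF \<mu> continuous_on_psi_kernel[OF z]])
  have "- 1 / 2 < - 1 / 2 + (1 - norm z ^ 2) / 8"
    using z by (simp add: power_less_one_iff abs_square_less_1)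
  also have "\<dots> = (\<integral>x. - 1 / 2 + (1 - norm z ^ 2) / 8 \<partial>\<mu>)"
    by (simp add: prob_space)
  also have "\<dots> \<le> (\<integral>x. Re (z * x / (1 - z * x)) \<partial>\<mu>)"
    by (rule integral_mono)
       (use int z space_circle_prob[OF \<mu>] Re_psi_kernel_gt[OF z] in auto)
  also have "\<dots> = Re (psi_transform \<mu> z)"
    unfolding psi_transform_def by (rule integral_Re[OF int])
  finally show ?thesis .
qed

text \<open>The half-plane consists of the points that are closer to \<open>0\<close> than to
  \<open>- 1\<close>.\<close>

lemma norm_divide_one_plus_less_1:
  fixes w :: complex
  assumes "Re w > - 1 / 2"
  shows "1 + w \<noteq> 0" "norm (w / (1 + w)) < 1"
proof -
  show nz: "1 + w \<noteq> 0" using assms by (auto simp: complex_eq_iff)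
  have "norm w ^ 2 < norm (1 + w) ^ 2"
    using assms by (simp add: cmod_power2) (simp add: power2_eq_square algebra_simps)
  then have "norm w < norm (1 + w)" by (rule power2_less_imp_less) simp
  then show "norm (w / (1 + w)) < 1" using nz by (simp add: norm_divide)
qed

section \<open>K-transforms as self-maps of the disc\<close>

lemma psi_transform_0 [simp]: "psi_transform \<mu> 0 = 0"
  by (simp add: psi_transform_def)

lemma K_transform_0 [simp]: "K_transform \<mu> 0 = 0"
  by (simp add: K_transform_def)

lemma K_transform_maps_disc:
  assumes "circle_prob \<mu>" "norm z < 1" shows "norm (K_transform \<mu> z) < 1"
  unfolding K_transform_def
  by (intro norm_divide_one_plus_less_1 Re_psi_transform_gt assms)

lemma psi_transform_eq_K:
  assumes "circle_prob \<mu>" "norm z < 1"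
  shows "psi_transform \<mu> z = K_transform \<mu> z / (1 - K_transform \<mu> z)"
  unfolding K_transform_def
  using norm_divide_one_plus_less_1(1)[OF Re_psi_transform_gt[OF assms]] by (simp add: field_simps)

lemma holomorphic_K_transform:
  assumes "circle_prob \<mu>" shows "K_transform \<mu> holomorphic_on unit_disc"
proof -
  have "1 + psi_transform \<mu> z \<noteq> 0" if "z \<in> unit_disc" for z
    using that norm_divide_one_plus_less_1(1)[OF Re_psi_transform_gt[OF assms]] by simp
  then show ?thesis
    unfolding K_transform_def[abs_def]
    by (intro holomorphic_intros holomorphic_psi_transform assms)
qed

lemma deriv_K_transform_0:
  assumes "circle_prob \<mu>" shows "deriv (K_transform \<mu>) 0 = circle_moment \<mu> 1"
proof -
  obtain h where h: "h holomorphic_on unit_disc" "h 0 = circle_moment \<mu> 1"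
    "\<And>z. z \<in> unit_disc \<Longrightarrow> psi_transform \<mu> z = z * h z"
    using psi_transform_factor[OF assms] by blast
  have hd: "(h has_field_derivative deriv h 0) (at 0)"
    using h(1) by (intro holomorphic_derivI[of h unit_disc]) auto
  have "((\<lambda>z. (z * h z) / (1 + z * h z)) has_field_derivative h 0) (at 0)"
    by (rule derivative_eq_intros hd | simp)+
  then have "(K_transform \<mu> has_field_derivative h 0) (at 0)"
    by (rule has_field_derivative_transform_within_open[of _ _ _ unit_disc])
       (auto simp: h(3) K_transform_def)
  then show ?thesis using h(2) DERIV_imp_deriv by metis
qed

lemma K_transform_return:
  assumes "norm c = 1" "norm z < 1"
  shows "K_transform (return circle_borel c) z = c * z"
proof -
  have m: "(\<lambda>x. z * x / (1 - z * x)) \<in> borel_measurable circle_borel"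
    unfolding circle_borel_def
    by (rule borel_measurable_continuous_on_restrict[OF continuous_on_psi_kernel]) fact
  have "psi_transform (return circle_borel c) z = z * c / (1 - z * c)"
    unfolding psi_transform_def
    by (rule integral_return) (use m assms in \<open>auto simp: circle_borel_def space_restrict_space\<close>)
  moreover have "1 + z * c / (1 - z * c) = 1 / (1 - z * c)"
    using one_minus_mult_circle[OF assms(2,1)] by (simp add: add_divide_eq_iff)
  ultimately show ?thesis
    using one_minus_mult_circle[OF assms(2,1)] by (simp add: K_transform_def)
qed

lemma circle_prob_return: "norm c = 1 \<Longrightarrow> circle_prob (return circle_borel c)"
  by (simp add: circle_prob_def prob_space_return circle_borel_def space_restrict_space)

section \<open>Recovery of moments, integrals and measures from the K-transform\<close>

lemma circle_moment_limit:
  assumes \<mu>: "circle_prob \<mu>" and z: "0 < norm z" "norm z < 1"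
  shows "norm ((psi_transform \<mu> z - (\<Sum>k<n. circle_moment \<mu> (Suc k) * z ^ Suc k)) / z ^ Suc n
            - circle_moment \<mu> (Suc n)) \<le> norm z / (1 - norm z)"
proof -
  have "z ^ Suc n \<noteq> 0" using z by auto
  then have "(psi_transform \<mu> z - (\<Sum>k<n. circle_moment \<mu> (Suc k) * z ^ Suc k)) / z ^ Suc n
            - circle_moment \<mu> (Suc n)
    = (psi_transform \<mu> z - (\<Sum>k<Suc n. circle_moment \<mu> (Suc k) * z ^ Suc k)) / z ^ Suc n"
    by (simp add: diff_divide_distrib add_divide_distrib)
  also have "norm \<dots> \<le> (norm z ^ Suc (Suc n) / (1 - norm z)) / norm (z ^ Suc n)"
    unfolding norm_divide by (intro divide_right_mono psi_transform_taylor \<mu> z) simp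
  also have "\<dots> = norm z / (1 - norm z)"
    using z by (simp add: norm_power norm_mult field_simps)
  finally show ?thesis .
qed

lemma circle_moment_0: "circle_prob \<mu> \<Longrightarrow> circle_moment \<mu> 0 = 1"
  by (simp add: circle_moment_def circle_prob_def prob_space.prob_space)

text \<open>Strong induction on the index: by \<open>circle_moment_limit\<close>, the next moment is
  a limit, uniform in \<open>t\<close>, of expressions in \<open>psi_transform (M t) z\<close> and
  the earlier moments. Each of these is continuous in \<open>t\<close>, since
  \<open>psi_transform\<close> at a fixed \<open>z\<close> is a rational function of the K-transform
  there.\<close>

lemma continuous_on_circle_moment:
  fixes M :: "'a::topological_space \<Rightarrow> complex measure"
  assumes M: "\<And>t. t \<in> T \<Longrightarrow> circle_prob (M t)"
    and K: "\<And>z. z \<in> unit_disc \<Longrightarrow> continuous_on T (\<lambda>t. K_transform (M t) z)"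
  shows "continuous_on T (\<lambda>t. circle_moment (M t) n)"
proof (cases n)
  case 0
  then show ?thesis
    using M by (simp add: circle_moment_0 cong: continuous_on_cong)
next
  case (Suc m)
  have psi: "continuous_on T (\<lambda>t. psi_transform (M t) z)" if z: "z \<in> unit_disc" for z
  proof -
    have "continuous_on T (\<lambda>t. K_transform (M t) z / (1 - K_transform (M t) z))"
      using K_transform_maps_disc M z by (intro continuous_intros K[OF z]) force
    then show ?thesis
      by (rule continuous_on_eq) (use z M psi_transform_eq_K in auto)
  qed
  have "continuous_on T (\<lambda>t. circle_moment (M t) (Suc m))"
  proof (induction m rule: less_induct)
    case (less n)
    let ?f = "\<lambda>z t. (psi_transform (M t) z - (\<Sum>k<n. circle_moment (M t) (Suc k) * z ^ Suc k)) / z ^ Suc n"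
    \<comment> \<open>The sample points \<open>1 / (j + 2)\<close> tend to \<open>0\<close> and lie
      strictly between \<open>0\<close> and \<open>1\<close> already for \<open>j = 0\<close>, as
      the error bound requires.\<close>
    have "uniform_limit T (\<lambda>j. ?f (of_real (1 / real (j + 2)))) (\<lambda>t. circle_moment (M t) (Suc n)) sequentially"
    proof (rule uniform_limitI)
      fix e :: real assume e: "e > 0"
      have "(\<lambda>j. (1 / real (j + 2)) / (1 - 1 / real (j + 2))) \<longlonglongrightarrow> 0"
        by real_asymp
      then have "eventually (\<lambda>j. (1 / real (j + 2)) / (1 - 1 / real (j + 2)) < e) sequentially"
        using e by (rule order_tendstoD)
      then show "\<forall>\<^sub>F j in sequentially. \<forall>t\<in>T. dist (?f (of_real (1 / real (j + 2))) t) (circle_moment (M t) (Suc n)) < e"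
      proof (rule eventually_mono, intro ballI)
        fix j t assume j: "1 / real (j + 2) / (1 - 1 / real (j + 2)) < e" and t: "t \<in> T"
        have nz: "norm (complex_of_real (1 / real (j + 2))) = 1 / real (j + 2)"
          by (simp add: norm_divide del: of_real_add)
        show "dist (?f (of_real (1 / real (j + 2))) t) (circle_moment (M t) (Suc n)) < e"
          unfolding dist_norm
          by (rule le_less_trans[OF circle_moment_limit[OF M[OF t]]]) (use j nz in \<open>simp_all only:, auto\<close>)
      qed
    qed
    then show ?case
    proof (rule uniform_limit_theorem[rotated])
      have "continuous_on T (?f (of_real (1 / real (j + 2))))" for j
        by (intro continuous_intros less.IH psi) (auto simp: norm_divide simp flip: of_real_add)
      then show "\<forall>\<^sub>F j in sequentially. continuous_on T (?f (of_real (1 / real (j + 2))))"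
        by simp
    qed simp
  qed
  then show ?thesis using Suc by simp
qed

text \<open>Uniqueness comes from continuity, applied to a family that jumps from \<open>\<mu>\<close> to \<open>\<nu>\<close>
  while its K-transform stays constant.\<close>
lemma circle_moment_eqI:
  assumes "circle_prob \<mu>" "circle_prob \<nu>"
    and "\<And>z. z \<in> unit_disc \<Longrightarrow> K_transform \<mu> z = K_transform \<nu> z"
  shows "circle_moment \<mu> n = circle_moment \<nu> n"
proof -
  define M where "M t = (if t \<le> 0 then \<mu> else \<nu>)" for t :: real
  have "continuous_on UNIV (\<lambda>t. circle_moment (M t) n)"
  proof (rule continuous_on_circle_moment)
    fix z :: complex assume "z \<in> unit_disc"
    then have "(\<lambda>t. K_transform (M t) z) = (\<lambda>t. K_transform \<mu> z)"
      using assms(3) by (auto simp: M_def)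
    then show "continuous_on UNIV (\<lambda>t. K_transform (M t) z)" by (simp only: continuous_on_const)
  qed (use assms in \<open>auto simp: M_def\<close>)
  then have "((\<lambda>t. circle_moment (M t) n) \<longlongrightarrow> circle_moment (M 0) n) (at_right 0)"
    by (auto simp: continuous_on_def intro: tendsto_within_subset)
  moreover have "eventually (\<lambda>t. circle_moment (M t) n = circle_moment \<nu> n) (at_right 0)"
    by (rule eventually_at_right_less[THEN eventually_mono]) (simp add: M_def)
  ultimately have "((\<lambda>t. circle_moment \<nu> n) \<longlongrightarrow> circle_moment (M 0) n) (at_right (0::real))"
    by (rule Lim_transform_eventually)
  then have "circle_moment \<nu> n = circle_moment (M 0) n"
    by (simp add: tendsto_const_iff)
  then show ?thesis by (simp add: M_def)
qed

text \<open>The set \<open>P\<close> in the proof is closed under multiplication by \<open>x\<close> and \<open>cnj x\<close>, hence by every real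
  polynomial in the coordinates; Stone--Weierstrass then reduces the claim to the moments.\<close>
lemma continuous_on_circle_integral:
  fixes M :: "'a::topological_space \<Rightarrow> complex measure"
  assumes M: "\<And>t. t \<in> T \<Longrightarrow> circle_prob (M t)"
    and mom: "\<And>n. continuous_on T (\<lambda>t. circle_moment (M t) n)"
    and f: "continuous_on unit_circle (f :: complex \<Rightarrow> real)"
  shows "continuous_on T (\<lambda>t. \<integral>x. f x \<partial>M t)"
proof -
  have intg: "integrable (M t) g" if "t \<in> T" "continuous_on unit_circle g" for t and g :: "complex \<Rightarrow> complex"
    by (rule integrable_circle_prob[OF M]) (use that in auto)
  have mono: "continuous_on T (\<lambda>t. \<integral>x. x ^ k * cnj x ^ l \<partial>M t)" for k l
  proof -
    \<comment> \<open>Since \<open>x * cnj x = 1\<close> on the circle, a mixed monomial collapses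
      to a power of \<open>x\<close> or of its conjugate, so its integral is a moment or a
      conjugated moment.\<close>
    have red: "x ^ k * cnj x ^ l = (if l \<le> k then x ^ (k - l) else cnj (x ^ (l - k)))"
      if "x \<in> unit_circle" for x :: complex
    proof -
      have 1: "x * cnj x = 1" using that by (simp add: complex_norm_square[symmetric])
      show ?thesis
      proof (cases "l \<le> k")
        case True
        then have "x ^ k * cnj x ^ l = x ^ (k - l) * (x * cnj x) ^ l"
          by (simp add: power_mult_distrib mult.assoc[symmetric] power_add[symmetric])
        then show ?thesis using True 1 by simp
      next
        case False
        then have "x ^ k * cnj x ^ l = cnj x ^ (l - k) * (x * cnj x) ^ k"
          by (simp add: power_mult_distrib mult.left_commute power_add[symmetric])
        then show ?thesis using False 1 by simp
      qed
    qed
    have eq: "(\<integral>x. x ^ k * cnj x ^ l \<partial>M t)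
      = (if l \<le> k then circle_moment (M t) (k - l) else cnj (circle_moment (M t) (l - k)))"
      if "t \<in> T" for t
    proof -
      have "(\<integral>x. x ^ k * cnj x ^ l \<partial>M t)
        = (\<integral>x. (if l \<le> k then x ^ (k - l) else cnj (x ^ (l - k))) \<partial>M t)"
        by (rule Bochner_Integration.integral_cong) (use red space_circle_prob[OF M[OF that]] in auto)
      then show ?thesis
        by (simp add: circle_moment_def del: complex_cnj_power)
    qed
    have "continuous_on T (\<lambda>t. if l \<le> k then circle_moment (M t) (k - l) else cnj (circle_moment (M t) (l - k)))"
      by (cases "l \<le> k") (auto intro!: continuous_intros mom)
    then show ?thesis by (rule continuous_on_eq) (use eq in auto)
  qed
  define P where "P = {g :: complex \<Rightarrow> complex. continuous_on unit_circle g \<and>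
      (\<forall>k l. continuous_on T (\<lambda>t. \<integral>x. g x * (x ^ k * cnj x ^ l) \<partial>M t))}"
  have P_add: "(\<lambda>x. g x + h x) \<in> P" if "g \<in> P" "h \<in> P" for g h
  proof -
    have "continuous_on T (\<lambda>t. \<integral>x. (g x + h x) * (x ^ k * cnj x ^ l) \<partial>M t)" for k l
    proof (rule continuous_on_eq)
      show "continuous_on T (\<lambda>t. (\<integral>x. g x * (x ^ k * cnj x ^ l) \<partial>M t) + (\<integral>x. h x * (x ^ k * cnj x ^ l) \<partial>M t))"
        using that by (intro continuous_intros) (auto simp: P_def)
    next
      fix t assume "t \<in> T"
      then show "(\<integral>x. g x * (x ^ k * cnj x ^ l) \<partial>M t) + (\<integral>x. h x * (x ^ k * cnj x ^ l) \<partial>M t)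
        = (\<integral>x. (g x + h x) * (x ^ k * cnj x ^ l) \<partial>M t)"
        using that unfolding distrib_right
        by (intro Bochner_Integration.integral_add[symmetric] intg continuous_intros) (auto simp: P_def)
    qed
    then show ?thesis using that by (auto simp: P_def intro: continuous_intros)
  qed
  have P_lin: "(\<lambda>x. c * x * g x + d * cnj x * g x) \<in> P" if "g \<in> P" for g c d
  proof -
    have "continuous_on T (\<lambda>t. \<integral>x. (c * x * g x + d * cnj x * g x) * (x ^ k * cnj x ^ l) \<partial>M t)" for k l
    proof (rule continuous_on_eq)
      show "continuous_on T (\<lambda>t. c * (\<integral>x. g x * (x ^ Suc k * cnj x ^ l) \<partial>M t) + d * (\<integral>x. g x * (x ^ k * cnj x ^ Suc l) \<partial>M t))"
        using that by (intro continuous_intros) (auto simp: P_def simp del: power_Suc)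
    next
      fix t assume t: "t \<in> T"
      have g: "continuous_on unit_circle g" using that by (simp add: P_def)
      have "c * (\<integral>x. g x * (x ^ Suc k * cnj x ^ l) \<partial>M t) + d * (\<integral>x. g x * (x ^ k * cnj x ^ Suc l) \<partial>M t)
        = (\<integral>x. c * (g x * (x ^ Suc k * cnj x ^ l)) + d * (g x * (x ^ k * cnj x ^ Suc l)) \<partial>M t)"
        by (subst Bochner_Integration.integral_add)
           (auto intro!: intg[OF t] continuous_intros g simp del: power_Suc)
      also have "\<dots> = (\<integral>x. (c * x * g x + d * cnj x * g x) * (x ^ k * cnj x ^ l) \<partial>M t)"
        by (simp add: algebra_simps)
      finally show "c * (\<integral>x. g x * (x ^ Suc k * cnj x ^ l) \<partial>M t) + d * (\<integral>x. g x * (x ^ k * cnj x ^ Suc l) \<partial>M t)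
        = (\<integral>x. (c * x * g x + d * cnj x * g x) * (x ^ k * cnj x ^ l) \<partial>M t)" .
    qed
    then show ?thesis using that by (auto simp: P_def intro!: continuous_intros)
  qed
  have P_lin_const: "(\<lambda>x. of_real c * g x) \<in> P" if "g \<in> P" for g and c :: real
  proof -
    have "continuous_on T (\<lambda>t. of_real c * (\<integral>x. g x * (x ^ k * cnj x ^ l) \<partial>M t))" for k l
      using that by (intro continuous_intros) (auto simp: P_def)
    then show ?thesis using that by (auto simp: P_def mult.assoc intro: continuous_intros)
  qed
  have P_const: "(\<lambda>x. c) \<in> P" for c
    using mono by (auto simp: P_def intro!: continuous_intros)
  have poly: "(\<lambda>x. of_real (p x) * h x) \<in> P" if "real_polynomial_function p" "h \<in> P" for p h
    using that
  proof (induction arbitrary: h rule: real_polynomial_function.induct)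
    case (linear p)
    interpret p: bounded_linear p by fact
    \<comment> \<open>The Wirtinger coefficients of a real-linear functional of the plane, for which
      it becomes \<open>c * x + d * cnj x\<close>.\<close>
    define c d where "c = (of_real (p 1) - \<i> * of_real (p \<i>)) / 2"
      and "d = (of_real (p 1) + \<i> * of_real (p \<i>)) / 2"
    have "of_real (p x) = c * x + d * cnj x" for x
    proof -
      have "p x = p (Re x *\<^sub>R 1 + Im x *\<^sub>R \<i>)"
        by (rule arg_cong[of _ _ p]) (simp add: complex_eq_iff)
      also have "\<dots> = Re x * p 1 + Im x * p \<i>"
        by (simp only: p.add p.scaleR real_scaleR_def)
      finally show ?thesis
        by (simp add: c_def d_def complex_eq_iff field_simps)
    qed
    then show ?case using P_lin[OF linear(2), of c d] by (simp add: distrib_right)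
  next
    case (const c)
    then show ?case using P_lin_const by simp
  next
    case (add p q)
    then show ?case using P_add by (simp add: distrib_right)
  next
    case (mult p q)
    then have "(\<lambda>x. of_real (p x) * (of_real (q x) * h x)) \<in> P" by blast
    then show ?case by (simp add: mult.assoc)
  qed
  have cont: "continuous_on T (\<lambda>t. \<integral>x. p x \<partial>M t)" if "real_polynomial_function p" for p
  proof -
    have "(\<lambda>x. of_real (p x) * 1) \<in> P"
      by (rule poly[OF that P_const])
    then have "continuous_on T (\<lambda>t. \<integral>x. of_real (p x) * 1 * (x ^ 0 * cnj x ^ 0) \<partial>M t)"
      unfolding P_def by blast
    then have "continuous_on T (\<lambda>t. of_real (\<integral>x. p x \<partial>M t) :: complex)"
      by simp
    then have "continuous_on T (\<lambda>t. Re (of_real (\<integral>x. p x \<partial>M t)))"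
      by (rule continuous_on_Re)
    then show ?thesis by simp
  qed
  have "\<exists>p. real_polynomial_function p \<and> (\<forall>x\<in>unit_circle. \<bar>f x - p x\<bar> < inverse (real (Suc n)))" for n
    using Stone_Weierstrass_real_polynomial_function[OF compact_sphere f, of "inverse (real (Suc n))"]
    by (metis inverse_positive_iff_positive of_nat_0_less_iff zero_less_Suc)
  then obtain p where p: "\<And>n. real_polynomial_function (p n)"
    "\<And>n x. x \<in> unit_circle \<Longrightarrow> \<bar>f x - p n x\<bar> < inverse (real (Suc n))"
    by metis
  have "uniform_limit T (\<lambda>n t. \<integral>x. p n x \<partial>M t) (\<lambda>t. \<integral>x. f x \<partial>M t) sequentially"
  proof (rule uniform_limitI)
    fix e :: real assume e: "e > 0"
    have "eventually (\<lambda>n. inverse (real (Suc n)) < e) sequentially"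
      using LIMSEQ_inverse_real_of_nat e by (rule order_tendstoD)
    then show "\<forall>\<^sub>F n in sequentially. \<forall>t\<in>T. dist (\<integral>x. p n x \<partial>M t) (\<integral>x. f x \<partial>M t) < e"
    proof (rule eventually_mono, intro ballI)
      fix n t assume n: "inverse (real (Suc n)) < e" and t: "t \<in> T"
      have pc: "continuous_on unit_circle (p n)"
        using p(1) real_polynomial_function_eq continuous_on_polymonial_function by blast
      have "(\<integral>x. p n x \<partial>M t) - (\<integral>x. f x \<partial>M t) = (\<integral>x. p n x - f x \<partial>M t)"
        by (rule Bochner_Integration.integral_diff[symmetric]; rule integrable_circle_prob[OF M[OF t]])
           (fact pc f)+
      also have "norm \<dots> \<le> inverse (real (Suc n))"
        by (rule norm_integral_circle_prob_le[OF M[OF t]])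
           (use p(2) in \<open>auto intro!: continuous_intros pc f less_imp_le simp: abs_minus_commute\<close>)
      finally show "dist (\<integral>x. p n x \<partial>M t) (\<integral>x. f x \<partial>M t) < e"
        using n by (simp add: dist_norm)
    qed
  qed
  then show ?thesis
    by (rule uniform_limit_theorem[rotated]) (use p(1) cont in auto)
qed

text \<open>The jump argument again: a family that switches from \<mu> to \<nu> has constant
  moments, so its integrals are continuous and cannot jump.\<close>

lemma circle_integral_eqI:
  assumes "circle_prob \<mu>" "circle_prob \<nu>"
    and "\<And>n. circle_moment \<mu> n = circle_moment \<nu> n"
    and f: "continuous_on unit_circle (f :: complex \<Rightarrow> real)"
  shows "(\<integral>x. f x \<partial>\<mu>) = (\<integral>x. f x \<partial>\<nu>)"
proof -
  define M where "M t = (if t \<le> 0 then \<mu> else \<nu>)" for t :: real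
  have "continuous_on UNIV (\<lambda>t. \<integral>x. f x \<partial>M t)"
  proof (rule continuous_on_circle_integral[OF _ _ f])
    fix n
    have "(\<lambda>t. circle_moment (M t) n) = (\<lambda>t. circle_moment \<mu> n)"
      using assms(3) by (auto simp: M_def)
    then show "continuous_on UNIV (\<lambda>t. circle_moment (M t) n)" by (simp only: continuous_on_const)
  qed (use assms in \<open>auto simp: M_def\<close>)
  then have "((\<lambda>t. \<integral>x. f x \<partial>M t) \<longlongrightarrow> (\<integral>x. f x \<partial>M 0)) (at_right 0)"
    by (auto simp: continuous_on_def intro: tendsto_within_subset)
  moreover have "eventually (\<lambda>t. (\<integral>x. f x \<partial>M t) = (\<integral>x. f x \<partial>\<nu>)) (at_right 0)"
    by (rule eventually_at_right_less[THEN eventually_mono]) (simp add: M_def)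
  ultimately have "((\<lambda>t. \<integral>x. f x \<partial>\<nu>) \<longlongrightarrow> (\<integral>x. f x \<partial>M 0)) (at_right (0::real))"
    by (rule Lim_transform_eventually)
  then have "(\<integral>x. f x \<partial>\<nu>) = (\<integral>x. f x \<partial>M 0)"
    by (simp add: tendsto_const_iff)
  then show ?thesis by (simp add: M_def)
qed

text \<open>Indicators of closed sets are pointwise limits of bounded continuous functions, and the
  traces of closed sets on the circle form an intersection-stable generator of the
  sigma-algebra.\<close>

lemma circle_prob_eqI:
  assumes \<mu>: "circle_prob \<mu>" and \<nu>: "circle_prob \<nu>"
    and eq: "\<And>f :: complex \<Rightarrow> real. continuous_on UNIV f \<Longrightarrow> (\<integral>x. f x \<partial>\<mu>) = (\<integral>x. f x \<partial>\<nu>)"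
  shows "\<mu> = \<nu>"
proof -
  interpret \<mu>: prob_space \<mu> using \<mu> by (simp add: circle_prob_def)
  interpret \<nu>: prob_space \<nu> using \<nu> by (simp add: circle_prob_def)
  have sets: "sets \<mu> = sets (restrict_space borel unit_circle)" "sets \<nu> = sets (restrict_space borel unit_circle)"
    using \<mu> \<nu> by (simp_all add: circle_prob_def circle_borel_def)
  have sp: "space \<mu> = unit_circle" "space \<nu> = unit_circle"
    using \<mu> \<nu> by (simp_all add: space_circle_prob)
  have meas: "measure \<mu> (C \<inter> unit_circle) = measure \<nu> (C \<inter> unit_circle)" if C: "closed C" for C
  proof (cases "C = {}")
    case False
    \<comment> \<open>For \<open>n > 0\<close>, this is \<open>1\<close> on \<open>C\<close> and
      \<open>0\<close> at distance at least \<open>1 / n\<close> from it. The empty set is treated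
      apart because \<open>infdist x {} = 0\<close> would make every \<open>f n\<close> equal to
      \<open>1\<close>.\<close>
    define f where "f n x = max 0 (1 - real n * infdist x C)" for n x
    have fc: "continuous_on UNIV (f n)" for n
      unfolding f_def by (intro continuous_intros)
    have lim: "(\<lambda>n. f n x) \<longlonglongrightarrow> indicator C x" for x
    proof (cases "x \<in> C")
      case True
      then show ?thesis by (simp add: f_def infdist_zero)
    next
      case x: False
      then have pos: "infdist x C > 0"
        using C False infdist_pos_not_in_closed by blast
      obtain N :: nat where N: "1 < real N * infdist x C" using pos reals_Archimedean3 by blast
      have "f n x = 0" if "n \<ge> N" for n
      proof -
        have "real N * infdist x C \<le> real n * infdist x C"
          using that pos by (intro mult_right_mono) auto
        then show ?thesis using N by (simp add: f_def)
      qed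
      then have "eventually (\<lambda>n. f n x = 0) sequentially"
        using eventually_sequentially by blast
      then show ?thesis using x by (simp add: tendsto_eventually)
    qed
    have conv: "(\<lambda>n. \<integral>x. f n x \<partial>\<rho>) \<longlonglongrightarrow> measure \<rho> (C \<inter> unit_circle)" if \<rho>: "circle_prob \<rho>" for \<rho>
    proof -
      interpret prob_space \<rho> using \<rho> by (simp add: circle_prob_def)
      have Cs: "C \<inter> unit_circle \<in> sets \<rho>"
        using \<rho> C by (auto simp: circle_prob_def circle_borel_def sets_restrict_space)
      have "(\<lambda>n. \<integral>x. f n x \<partial>\<rho>) \<longlonglongrightarrow> (\<integral>x. indicator (C \<inter> unit_circle) x \<partial>\<rho>)"
      proof (rule integral_dominated_convergence[where w = "\<lambda>_. 1"])
        show "f n \<in> borel_measurable \<rho>" for n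
          by (rule borel_measurable_circle_prob[OF \<rho>]) (rule continuous_on_subset[OF fc], simp)
        show "AE x in \<rho>. (\<lambda>n. f n x) \<longlonglongrightarrow> indicator (C \<inter> unit_circle) x"
          using lim space_circle_prob[OF \<rho>] by (intro AE_I2) (auto simp: indicator_def)
      qed (use Cs in \<open>auto simp: f_def infdist_nonneg\<close>)
      then show ?thesis using Cs by simp
    qed
    have "(\<lambda>n. \<integral>x. f n x \<partial>\<mu>) \<longlonglongrightarrow> measure \<nu> (C \<inter> unit_circle)"
      using conv[OF \<nu>] eq[OF fc] by simp
    then show ?thesis using conv[OF \<mu>] LIMSEQ_unique by blast
  qed simp
  let ?E = "(\<lambda>C. C \<inter> unit_circle) ` {C. closed C}"
  have sig: "sets (restrict_space borel unit_circle) = sigma_sets unit_circle ?E"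
    using sigma_sets_Int[of unit_circle UNIV "Collect closed"]
    by (simp add: sets_restrict_space borel_eq_closed Int_commute image_def closed_sphere sigma_sets.Basic)
  show ?thesis
  proof (rule measure_eqI_generator_eq[where E = ?E and \<Omega> = unit_circle and A = "\<lambda>_. unit_circle"])
    show "Int_stable ?E"
    proof (rule Int_stableI)
      fix a b assume "a \<in> ?E" "b \<in> ?E"
      then obtain C D where "closed C" "closed D" "a = C \<inter> unit_circle" "b = D \<inter> unit_circle" by blast
      then show "a \<inter> b \<in> ?E" by (intro image_eqI[of _ _ "C \<inter> D"]) auto
    qed
    show "range (\<lambda>_. unit_circle) \<subseteq> ?E" by (auto intro!: image_eqI[of _ _ UNIV])
    show "emeasure \<mu> X = emeasure \<nu> X" if "X \<in> ?E" for X
      using that meas by (auto simp: \<mu>.emeasure_eq_measure \<nu>.emeasure_eq_measure)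
  qed (use sets sig in auto)
qed

lemma K_transform_inject:
  assumes "circle_prob \<mu>" "circle_prob \<nu>"
    and "\<And>z. z \<in> unit_disc \<Longrightarrow> K_transform \<mu> z = K_transform \<nu> z"
  shows "\<mu> = \<nu>"
proof (rule circle_prob_eqI[OF assms(1,2)])
  fix f :: "complex \<Rightarrow> real" assume "continuous_on UNIV f"
  then show "(\<integral>x. f x \<partial>\<mu>) = (\<integral>x. f x \<partial>\<nu>)"
    by (intro circle_integral_eqI assms circle_moment_eqI) (auto intro: continuous_on_subset)
qed

section \<open>Herglotz' representation\<close>

lemma has_integral_circle_Cauchy:
  fixes f :: "complex \<Rightarrow> complex"
  assumes "f holomorphic_on cball 0 1" "norm z < 1"
  shows "((\<lambda>t. f (cis t) * cis t / (cis t - z)) has_integral (2 * pi * f z)) {0..2*pi}"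
proof -
  have "((\<lambda>u. f u / (u - z)) has_contour_integral (2 * of_real pi * \<i> * f z)) (circlepath 0 1)"
    using assms by (intro Cauchy_integral_circlepath_simple) auto
  then have "((\<lambda>t. f (cis t) / (cis t - z) * \<i> * cis t) has_integral (2 * of_real pi * \<i> * f z)) {0..2*pi}"
    unfolding circlepath_def by (subst (asm) has_contour_integral_part_circlepath_iff) (auto simp: mult_ac)
  from has_integral_mult_right[OF this, of "- \<i>"] show ?thesis
    by (simp add: mult_ac)
qed

lemma psi_kernel_inverse:
  fixes c z :: complex
  assumes "c \<noteq> 0" "c \<noteq> z"
  shows "z * inverse c / (1 - z * inverse c) = z / (c - z)"
  using assms by (simp add: field_simps)

text \<open>The difference of Cauchy's formulas at \<open>z\<close> and at \<open>0\<close> has the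
  kernel \<open>z / (cis t - z)\<close>. Against the same kernel \<open>cnj F\<close> integrates to
  \<open>0\<close>, so adding it replaces \<open>F\<close> by twice its real part.\<close>

lemma Herglotz_circle:
  fixes F :: "complex \<Rightarrow> complex"
  assumes F: "F holomorphic_on cball 0 1" "F 0 = 1" and z: "norm z < 1"
  shows "((\<lambda>t. Re (F (cis t)) * (z / (cis t - z))) has_integral (pi * (F z - 1))) {0..2*pi}"
proof -
  have nz: "cis t \<noteq> z" for t using z norm_cis[of t] by auto
  have "((\<lambda>t. F (cis t) * cis t / (cis t - z) - F (cis t) * cis t / (cis t - 0)) has_integral (2 * pi * F z - 2 * pi * F 0)) {0..2*pi}"
    by (intro has_integral_diff has_integral_circle_Cauchy F z) simp
  also have "(\<lambda>t. F (cis t) * cis t / (cis t - z) - F (cis t) * cis t / (cis t - 0)) = (\<lambda>t. F (cis t) * (z / (cis t - z)))"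
    using nz by (auto simp: field_simps)
  finally have 1: "((\<lambda>t. F (cis t) * (z / (cis t - z))) has_integral (2 * pi * (F z - 1))) {0..2*pi}"
    using F(2) by (simp add: algebra_simps)
  \<comment> \<open>On the circle conjugation is inversion, so \<open>cnj (g (cis t))\<close> is
    \<open>cnj (F (cis t))\<close> times the kernel above. As \<open>g\<close> is holomorphic on the
    closed disc and \<open>g 0 = 0\<close>, its mean over the circle vanishes.\<close>
  define g where "g w = F w * (cnj z * w / (1 - cnj z * w))" for w
  have "1 - cnj z * w \<noteq> 0" if "norm w \<le> 1" for w
  proof
    assume "1 - cnj z * w = 0"
    then have "norm (cnj z * w) = 1" by (metis eq_iff_diff_eq_0 norm_one)
    then have "norm z * norm w = 1" by (simp add: norm_mult)
    moreover have "norm z * norm w \<le> norm z * 1" using that by (intro mult_left_mono) auto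
    ultimately show False using z by simp
  qed
  then have "g holomorphic_on cball 0 1"
    unfolding g_def[abs_def] by (intro holomorphic_intros F) auto
  then have "((\<lambda>t. g (cis t) * cis t / (cis t - 0)) has_integral (2 * pi * g 0)) {0..2*pi}"
    by (rule has_integral_circle_Cauchy) simp
  then have "((\<lambda>t. g (cis t)) has_integral 0) {0..2*pi}"
    by (simp add: g_def)
  then have "((\<lambda>t. cnj (g (cis t))) has_integral 0) {0..2*pi}"
    using has_integral_cnj[of "\<lambda>t. g (cis t)" 0] by (simp add: o_def)
  moreover have "cnj (g (cis t)) = cnj (F (cis t)) * (z / (cis t - z))" for t
  proof -
    have "cnj (cis t) = inverse (cis t)" by (simp add: cis_cnj)
    then have "z * cnj (cis t) / (1 - z * cnj (cis t)) = z / (cis t - z)"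
      using psi_kernel_inverse[OF cis_neq_zero nz] by metis
    then show ?thesis
      by (simp only: g_def complex_cnj_mult complex_cnj_divide complex_cnj_diff complex_cnj_one complex_cnj_cnj)
  qed
  ultimately have "((\<lambda>t. cnj (F (cis t)) * (z / (cis t - z))) has_integral 0) {0..2*pi}" by simp
  from has_integral_add[OF 1 this]
  have "((\<lambda>t. (F (cis t) + cnj (F (cis t))) * (z / (cis t - z))) has_integral (2 * pi * (F z - 1))) {0..2*pi}"
    by (simp only: distrib_right add_0_right)
  then have "((\<lambda>t. 2 * (Re (F (cis t)) * (z / (cis t - z)))) has_integral (2 * (pi * (F z - 1)))) {0..2*pi}"
    by (simp add: complex_add_cnj mult.assoc)
  from has_integral_mult_right[OF this, of "1/2"] show ?thesis by simp
qed

lemma Herglotz_circle_mean: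
  fixes F :: "complex \<Rightarrow> complex"
  assumes F: "F holomorphic_on cball 0 1" "F 0 = 1"
  shows "((\<lambda>t. Re (F (cis t))) has_integral (2 * pi)) {0..2*pi}"
proof -
  have "((\<lambda>t. F (cis t) * cis t / (cis t - 0)) has_integral (2 * pi * F 0)) {0..2*pi}"
    by (rule has_integral_circle_Cauchy[OF F(1)]) simp
  from has_integral_linear[OF this bounded_linear_Re] F(2) show ?thesis by (simp add: o_def)
qed

text \<open>\<open>Re F / (2 * pi)\<close> is a probability density for the angle when
  \<open>F\<close> is holomorphic up to the circle. The interval \<open>{-1<..7}\<close> is any
  fixed half-open interval around \<open>{0..2*pi}\<close>, the shape in which tightness is
  expressed.\<close>

lemma circle_density_measure:
  fixes F :: "complex \<Rightarrow> complex"
  assumes F: "F holomorphic_on cball 0 1" "F 0 = 1" and pos: "\<And>w. norm w = 1 \<Longrightarrow> Re (F w) \<ge> 0"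
  obtains M where "real_distribution M" "measure M {-1<..7} = 1"
    "\<And>z. norm z < 1 \<Longrightarrow> (\<integral>t. z / (cis t - z) \<partial>M) = (F z - 1) / 2"
proof -
  let ?I = "{0..2*pi}"
  define d where "d t = indicator ?I t * (Re (F (cis t)) / (2 * pi))" for t :: real
  have cF: "continuous_on ?I (\<lambda>t. Re (F (cis t)))"
    by (intro continuous_intros continuous_on_compose2[OF holomorphic_on_imp_continuous_on[OF F(1)]]) auto
  have dpos: "d t \<ge> 0" for t using pos by (simp add: d_def)
  have dint: "set_integrable lborel ?I (\<lambda>t. Re (F (cis t)) / (2 * pi))"
    by (intro borel_integrable_atLeastAtMost' continuous_intros cF) auto
  then have dint': "integrable lborel d"
    by (simp add: set_integrable_def d_def[abs_def])
  have [measurable]: "d \<in> borel_measurable borel"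
    using borel_measurable_integrable[OF dint'] by simp
  have "(\<integral>t. d t \<partial>lborel) = integral ?I (\<lambda>t. Re (F (cis t)) / (2 * pi))"
    using set_borel_integral_eq_integral(2)[OF dint] by (simp add: set_lebesgue_integral_def d_def[abs_def])
  also have "\<dots> = 1"
    using has_integral_divide[OF Herglotz_circle_mean[OF F], of "2 * pi"] by (intro integral_unique) simp
  finally have d1: "(\<integral>t. d t \<partial>lborel) = 1" .
  define M where "M = density lborel d"
  have nn1: "(\<integral>\<^sup>+ t. ennreal (d t) \<partial>lborel) = 1"
    using nn_integral_eq_integral[OF dint'] dpos d1 by simp
  have pM: "prob_space M"
    by (rule prob_spaceI) (simp add: M_def emeasure_density nn1)
  interpret M: prob_space M by fact
  show ?thesis
  proof (rule that[of M])
    show "real_distribution M"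
      by (intro real_distribution.intro real_distribution_axioms.intro pM) (simp_all add: M_def)
    have "emeasure M {-1<..7} = (\<integral>\<^sup>+ t. ennreal (d t) * indicator {-1<..7} t \<partial>lborel)"
      by (simp add: M_def emeasure_density)
    also have "\<dots> = (\<integral>\<^sup>+ t. ennreal (d t) \<partial>lborel)"
      using pi_less_4 pi_approx by (intro nn_integral_cong) (auto simp: d_def indicator_def)
    finally show "measure M {-1<..7} = 1"
      using nn1 by (simp add: measure_def)
  next
    fix z :: complex assume z: "norm z < 1"
    have nz: "cis t - z \<noteq> 0" for t using z norm_cis[of t] by auto
    have cz: "continuous_on UNIV (\<lambda>t. z / (cis t - z))"
      using nz by (intro continuous_intros) auto
    have "set_integrable lborel ?I (\<lambda>t. (Re (F (cis t)) / (2 * pi)) *\<^sub>R (z / (cis t - z)))"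
      by (intro borel_integrable_atLeastAtMost' continuous_intros cF continuous_on_subset[OF cz]) (use nz in auto)
    then have "(LINT t:?I|lborel. (Re (F (cis t)) / (2 * pi)) *\<^sub>R (z / (cis t - z)))
       = integral ?I (\<lambda>t. (Re (F (cis t)) / (2 * pi)) *\<^sub>R (z / (cis t - z)))"
      by (rule set_borel_integral_eq_integral(2))
    also have "\<dots> = (F z - 1) / 2"
      using has_integral_mult_right[OF Herglotz_circle[OF F z], of "1 / (2 * pi)"]
      by (intro integral_unique) (simp add: scaleR_conv_of_real)
    also have "(LINT t:?I|lborel. (Re (F (cis t)) / (2 * pi)) *\<^sub>R (z / (cis t - z)))
      = (\<integral>t. d t *\<^sub>R (z / (cis t - z)) \<partial>lborel)"
      unfolding set_lebesgue_integral_def by (simp add: d_def[abs_def])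
    also have "\<dots> = (\<integral>t. z / (cis t - z) \<partial>M)"
      unfolding M_def using dpos borel_measurable_continuous_onI[OF cz]
      by (subst integral_density) auto
    finally show "(\<integral>t. z / (cis t - z) \<partial>M) = (F z - 1) / 2" .
  qed
qed

text \<open>For the measure sought, \<open>(1 + K) / (1 - K)\<close> must be
  \<open>1 + 2 * psi_transform \<mu>\<close>; it has nonnegative real part. Its dilations by
  \<open>\<rho> n\<close> are holomorphic up to the circle and hence come from densities. These live
  on one bounded interval, so a subsequence converges weakly, and for fixed \<open>z\<close> the
  kernel is a bounded continuous test function.\<close>

lemma K_transform_surj:
  assumes K: "K holomorphic_on unit_disc" "K 0 = 0" and maps: "\<And>z. norm z < 1 \<Longrightarrow> norm (K z) < 1"
  obtains \<mu> where "circle_prob \<mu>" "\<And>z. z \<in> unit_disc \<Longrightarrow> K_transform \<mu> z = K z"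
proof -
  define F where "F z = (1 + K z) / (1 - K z)" for z
  have K1: "K z \<noteq> 1" if "norm z < 1" for z using maps[OF that] by auto
  have F: "F holomorphic_on unit_disc"
    unfolding F_def[abs_def] using K1 by (intro holomorphic_intros K) auto
  have F0: "F 0 = 1" by (simp add: F_def K)
  have Fpos: "Re (F z) \<ge> 0" if "norm z < 1" for z
  proof -
    have "F z = (1 + K z) * cnj (1 - K z) / of_real (norm (1 - K z) ^ 2)"
      unfolding F_def using complex_div_cnj[of "1 + K z" "1 - K z"] by simp
    then have "Re (F z) = Re ((1 + K z) * cnj (1 - K z)) / norm (1 - K z) ^ 2"
      by (metis Re_divide_of_real)
    also have "Re ((1 + K z) * cnj (1 - K z)) = 1 - norm (K z) ^ 2"
      by (simp add: cmod_power2) (simp add: algebra_simps power2_eq_square)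
    finally have "Re (F z) = (1 - norm (K z) ^ 2) / norm (1 - K z) ^ 2" .
    moreover have "norm (K z) ^ 2 \<le> 1" using maps[OF that] by (simp add: power_le_one)
    ultimately show ?thesis by simp
  qed
  define \<rho> where "\<rho> n = 1 - 1 / real (n + 2)" for n
  have \<rho>: "0 < \<rho> n" "\<rho> n < 1" for n by (auto simp: \<rho>_def)
  have \<rho>z: "norm (of_real (\<rho> n) * z) < 1" if "norm z \<le> 1" for n and z :: complex
  proof -
    have "\<rho> n * norm z \<le> \<rho> n * 1" using that \<rho>[of n] by (intro mult_left_mono) auto
    then have "\<rho> n * norm z < 1" using \<rho>(2)[of n] by linarith
    then show ?thesis using \<rho>(1)[of n] by (simp add: norm_mult)
  qed
  have "\<exists>M. real_distribution M \<and> measure M {-1<..7} = 1 \<and>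
    (\<forall>z. norm z < 1 \<longrightarrow> (\<integral>t. z / (cis t - z) \<partial>M) = (F (of_real (\<rho> n) * z) - 1) / 2)" for n
  proof -
    have hF: "(\<lambda>z. F (of_real (\<rho> n) * z)) holomorphic_on cball 0 1"
    proof -
      have "(F \<circ> (\<lambda>z. of_real (\<rho> n) * z)) holomorphic_on cball 0 1"
        by (rule holomorphic_on_compose_gen[OF _ F]) (use \<rho>z in \<open>auto intro!: holomorphic_intros\<close>)
      then show ?thesis by (simp add: o_def)
    qed
    have p: "0 \<le> Re (F (of_real (\<rho> n) * w))" if "norm w = 1" for w
      using that by (intro Fpos \<rho>z) simp
    obtain M where "real_distribution M" "measure M {-1<..7} = 1"
      "\<And>z. norm z < 1 \<Longrightarrow> (\<integral>t. z / (cis t - z) \<partial>M) = (F (of_real (\<rho> n) * z) - 1) / 2"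
      using circle_density_measure[OF hF _ p] F0 by auto
    then show ?thesis by blast
  qed
  then obtain M where M: "\<And>n. real_distribution (M n)" "\<And>n. measure (M n) {-1<..7} = 1"
    "\<And>n z. norm z < 1 \<Longrightarrow> (\<integral>t. z / (cis t - z) \<partial>M n) = (F (of_real (\<rho> n) * z) - 1) / 2"
    by metis
  have "tight M"
    unfolding tight_def
  proof (intro conjI allI impI)
    fix e :: real assume "e > 0"
    then show "\<exists>a b. a < b \<and> (\<forall>n. 1 - e < measure (M n) {a<..b})"
      using M(2) by (intro exI[of _ "-1"] exI[of _ 7]) simp
  qed (rule M(1))
  from tight_imp_convergent_subsubsequence[OF this strict_mono_id]
  obtain r N where r: "strict_mono r" "real_distribution N" "weak_conv_m (M \<circ> r) N"
    by (auto simp: o_def id_def)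
  interpret N: real_distribution N by fact
  have lim\<rho>: "(\<lambda>n. \<rho> (r n)) \<longlonglongrightarrow> 1"
  proof -
    have "\<rho> \<longlonglongrightarrow> 1" unfolding \<rho>_def[abs_def] by real_asymp
    from LIMSEQ_subseq_LIMSEQ[OF this r(1)] show ?thesis by (simp add: o_def)
  qed
  have N: "(\<integral>t. z / (cis t - z) \<partial>N) = (F z - 1) / 2" if z: "norm z < 1" for z
  proof -
    have nz: "1 - norm z \<le> norm (cis t - z)" for t
      using norm_triangle_ineq2[of "cis t" z] by simp
    have "cis t - z \<noteq> 0" for t using nz[of t] z by auto
    then have "continuous_on UNIV (\<lambda>t. z / (cis t - z))" by (intro continuous_intros) auto
    then have "isCont (\<lambda>t. z / (cis t - z)) t" for t
      using continuous_on_eq_continuous_at[OF open_UNIV] by blast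
    then have "(\<lambda>n. \<integral>t. z / (cis t - z) \<partial>(M \<circ> r) n) \<longlonglongrightarrow> (\<integral>t. z / (cis t - z) \<partial>N)"
    proof (intro weak_conv_imp_integral_bdd_continuous_conv[where B = "norm z / (1 - norm z)"])
      show "weak_conv_m (M \<circ> r) N" by fact
      show "norm (z / (cis t - z)) \<le> norm z / (1 - norm z)" for t
        unfolding norm_divide using nz z by (intro frac_le) auto
    qed (use r(2) M(1) in auto)
    moreover have "(\<lambda>n. (F (of_real (\<rho> (r n)) * z) - 1) / 2) \<longlonglongrightarrow> (F z - 1) / 2"
    proof (intro tendsto_intros isCont_tendsto_compose[where g = F])
      show "isCont F z"
        using holomorphic_on_imp_continuous_on[OF F] continuous_on_eq_continuous_at[OF open_ball, of 0 1 F] z by auto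
      show "(\<lambda>n. of_real (\<rho> (r n)) * z) \<longlonglongrightarrow> z"
        using tendsto_mult[OF tendsto_of_real[OF lim\<rho>] tendsto_const[of z]] by simp
    qed simp
    moreover have "(\<lambda>n. \<integral>t. z / (cis t - z) \<partial>(M \<circ> r) n) = (\<lambda>n. (F (of_real (\<rho> (r n)) * z) - 1) / 2)"
      by (simp only: o_def M(3)[OF z])
    ultimately show ?thesis using LIMSEQ_unique by metis
  qed
  \<comment> \<open>The kernel of \<open>psi_transform\<close> at \<open>x = cis (- t)\<close> is
    \<open>z / (cis t - z)\<close>, hence the reversed angle.\<close>
  define \<mu> where "\<mu> = distr N circle_borel (\<lambda>t. cis (- t))"
  have meas: "(\<lambda>t. cis (- t)) \<in> measurable N circle_borel"
    unfolding circle_borel_def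
  proof (rule measurable_restrict_space2)
    have "(\<lambda>t. cis (- t)) \<in> borel_measurable borel"
      by (intro borel_measurable_continuous_onI continuous_intros)
    then show "(\<lambda>t. cis (- t)) \<in> borel_measurable N" by simp
  qed simp
  have \<mu>: "circle_prob \<mu>"
    unfolding circle_prob_def \<mu>_def by (simp add: N.prob_space_distr[OF meas])
  have psi: "psi_transform \<mu> z = (F z - 1) / 2" if z: "norm z < 1" for z
  proof -
    have "(\<lambda>x. z * x / (1 - z * x)) \<in> borel_measurable circle_borel"
      unfolding circle_borel_def
      by (rule borel_measurable_continuous_on_restrict[OF continuous_on_psi_kernel[OF z]])
    then have "psi_transform \<mu> z = (\<integral>t. z * cis (- t) / (1 - z * cis (- t)) \<partial>N)"
      unfolding psi_transform_def \<mu>_def by (rule integral_distr[OF meas])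
    also have "\<dots> = (\<integral>t. z / (cis t - z) \<partial>N)"
    proof (rule Bochner_Integration.integral_cong[OF refl])
      fix t
      have "cis t \<noteq> z" using z norm_cis[of t] by auto
      then show "z * cis (- t) / (1 - z * cis (- t)) = z / (cis t - z)"
        using psi_kernel_inverse[OF cis_neq_zero] by (metis cis_inverse)
    qed
    finally show ?thesis using N[OF z] by simp
  qed
  have "K_transform \<mu> z = K z" if "z \<in> unit_disc" for z
  proof -
    have "psi_transform \<mu> z = K z / (1 - K z)"
    proof -
      have "F z - 1 = 2 * (K z / (1 - K z))"
        using K1[of z] that by (simp add: F_def field_simps)
      moreover have "psi_transform \<mu> z = (F z - 1) / 2" using psi that by simp
      ultimately show ?thesis by (metis nonzero_mult_div_cancel_left zero_neq_numeral)
    qed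
    moreover have "1 + K z / (1 - K z) = 1 / (1 - K z)"
      using K1 that by (simp add: field_simps)
    ultimately show ?thesis using K1 that by (simp add: K_transform_def)
  qed
  then show ?thesis using that \<mu> by blast
qed

section \<open>Koenigs functions\<close>

lemma norm_deriv_le:
  fixes f :: "complex \<Rightarrow> complex"
  assumes "f holomorphic_on S" "cball w r \<subseteq> S" "r > 0"
    and "\<And>x. x \<in> cball w r \<Longrightarrow> norm (f x) \<le> B"
  shows "norm (deriv f w) \<le> B / r"
proof -
  have hol: "f holomorphic_on cball w r"
    using assms(1,2) by (rule holomorphic_on_subset)
  have "norm ((deriv ^^ 1) f w) \<le> fact 1 * B / r ^ 1"
  proof (rule Cauchy_inequality)
    show "f holomorphic_on ball w r"
      using hol by (rule holomorphic_on_subset) auto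
    show "continuous_on (cball w r) f"
      using hol by (rule holomorphic_on_imp_continuous_on)
    show "norm (f x) \<le> B" if "norm (w - x) = r" for x
      using that by (intro assms(4)) (simp add: dist_norm)
  qed (use assms in auto)
  then show ?thesis by simp
qed

text \<open>Cauchy's estimate on discs of the fixed radius \<open>r\<close> divides the error on
  \<open>B\<close> by \<open>r\<close>.\<close>

lemma uniform_limit_deriv:
  fixes f :: "nat \<Rightarrow> complex \<Rightarrow> complex"
  assumes S: "open S" and f: "\<And>n. f n holomorphic_on S" and g: "g holomorphic_on S"
    and lim: "uniform_limit B f g F" and sub: "\<And>w. w \<in> A \<Longrightarrow> cball w r \<subseteq> B" and B: "B \<subseteq> S" and r: "r > 0"
  shows "uniform_limit A (\<lambda>n. deriv (f n)) (deriv g) F"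
proof (rule uniform_limitI)
  fix e :: real assume e: "e > 0"
  have "\<forall>\<^sub>F n in F. \<forall>x\<in>B. dist (f n x) (g x) < e * r / 2"
    using lim e r by (intro uniform_limitD) auto
  then show "\<forall>\<^sub>F n in F. \<forall>x\<in>A. dist (deriv (f n) x) (deriv g x) < e"
  proof (rule eventually_mono, intro ballI)
    fix n w assume *: "\<forall>x\<in>B. dist (f n x) (g x) < e * r / 2" and w: "w \<in> A"
    have "w \<in> cball w r" using r by simp
    then have "w \<in> S" using sub[OF w] B by blast
    then have "deriv (\<lambda>x. f n x - g x) w = deriv (f n) w - deriv g w"
      using f g S by (intro deriv_diff) (auto intro: holomorphic_on_imp_differentiable_at)
    have bd: "norm (f n x - g x) \<le> e * r / 2" if "x \<in> cball w r" for x
      using * subsetD[OF sub[OF w] that] by (auto simp: dist_norm intro: less_imp_le)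
    have "norm (deriv (\<lambda>x. f n x - g x) w) \<le> (e * r / 2) / r"
      by (rule norm_deriv_le[of _ S])
         (use bd sub[OF w] B r f g in \<open>auto intro!: holomorphic_intros\<close>)
    with \<open>deriv (\<lambda>x. f n x - g x) w = deriv (f n) w - deriv g w\<close>
    show "dist (deriv (f n) w) (deriv g w) < e"
      using e r by (simp add: dist_norm)
  qed
qed

locale koenigs =
  fixes K :: "complex \<Rightarrow> complex" and \<kappa> :: complex
  assumes hol: "K holomorphic_on unit_disc"
    and maps: "\<And>z. norm z < 1 \<Longrightarrow> norm (K z) < 1"
    and K0: "K 0 = 0"
    and lam: "\<kappa> = deriv K 0" "\<kappa> \<noteq> 0" "norm \<kappa> < 1"
begin

lemma iter_maps: "norm z < 1 \<Longrightarrow> norm ((K ^^ n) z) < 1"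
  by (induction n) (auto simp: maps)

lemma iter_hol: "(K ^^ n) holomorphic_on unit_disc"
proof (induction n)
  case 0
  then show ?case by (simp add: id_def holomorphic_on_ident)
next
  case (Suc n)
  have "(K \<circ> (K ^^ n)) holomorphic_on unit_disc"
    by (rule holomorphic_on_compose_gen[OF Suc hol]) (use iter_maps in auto)
  then show ?case by (simp only: funpow.simps)
qed

lemma deriv_iter_Suc:
  assumes "norm z < 1"
  shows "deriv (K ^^ Suc n) z = deriv K ((K ^^ n) z) * deriv (K ^^ n) z"
  unfolding funpow.simps
  by (rule deriv_chain)
     (use assms iter_maps iter_hol hol in \<open>auto intro!: holomorphic_on_imp_differentiable_at[of _ unit_disc]\<close>)

lemma iter_0 [simp]: "(K ^^ n) 0 = 0"
  by (induction n) (auto simp: K0)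

text \<open>The quotient \<open>K z / z\<close> with its singularity at \<open>0\<close> removed;
  possible choices differ only outside the disc.\<close>

definition h where
  "h = (SOME h. h holomorphic_on unit_disc \<and> (\<forall>z. norm z < 1 \<longrightarrow> K z = z * h z) \<and> deriv K 0 = h 0)"

lemma h: "h holomorphic_on unit_disc" "norm z < 1 \<Longrightarrow> K z = z * h z" "h 0 = \<kappa>"
proof -
  have "\<exists>h. h holomorphic_on unit_disc \<and> (\<forall>z. norm z < 1 \<longrightarrow> K z = z * h z) \<and> deriv K 0 = h 0"
    using Schwarz3[OF hol K0] by metis
  from someI_ex[OF this, folded h_def]
  show "h holomorphic_on unit_disc" "norm z < 1 \<Longrightarrow> K z = z * h z" "h 0 = \<kappa>"
    using lam by auto
qed

lemma hol_h_iter: "(\<lambda>z. h ((K ^^ n) z)) holomorphic_on unit_disc"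
proof -
  have "(h \<circ> (K ^^ n)) holomorphic_on unit_disc"
    by (rule holomorphic_on_compose_gen[OF iter_hol h(1)]) (use iter_maps in auto)
  then show ?thesis by (simp only: o_def)
qed

text \<open>Equality in Schwarz' lemma at a single point would make \<open>K\<close> a rotation,
  whose derivative at \<open>0\<close> has modulus \<open>1\<close>.\<close>

lemma norm_h_less:
  assumes z: "norm z < 1" shows "norm (h z) < 1"
proof (cases "z = 0")
  case True
  then show ?thesis using lam h(3) by simp
next
  case False
  have le: "norm (K z) \<le> norm z"
    by (rule Schwarz_Lemma(1)[OF hol K0 maps z])
  have "norm (K z) \<noteq> norm z"
  proof
    assume "norm (K z) = norm z"
    then obtain \<alpha> where \<alpha>: "\<And>z. norm z < 1 \<Longrightarrow> K z = \<alpha> * z" "norm \<alpha> = 1"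
      using Schwarz_Lemma(3)[OF hol K0 maps z] z False by blast
    have "deriv K 0 = deriv (\<lambda>z. \<alpha> * z) 0"
      by (rule deriv_cong_ev) (auto intro!: eventually_nhds_in_open[of unit_disc, THEN eventually_mono] \<alpha>(1))
    then show False using lam \<alpha>(2) by simp
  qed
  with le have "norm (K z) < norm z" by simp
  then show ?thesis using h(2)[OF z] False by (simp add: norm_mult)
qed

text \<open>\<open>q\<close> is the maximum of \<open>norm (h z)\<close> on the closed disc. Since
  \<open>q < 1\<close>, the orbit stays in this disc, and each iteration gains the same
  factor.\<close>

lemma iter_geometric:
  assumes "R < 1"
  obtains q where "0 \<le> q" "q < 1" "\<And>z n. norm z \<le> R \<Longrightarrow> norm ((K ^^ n) z) \<le> q ^ n * norm z"
proof (cases "R \<ge> 0")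
  case True
  have "continuous_on (cball 0 R) (\<lambda>z. norm (h z))"
    using assms h(1) by (intro continuous_intros holomorphic_on_imp_continuous_on holomorphic_on_subset[OF h(1)]) auto
  then obtain w where w: "w \<in> cball 0 R" "\<And>z. z \<in> cball 0 R \<Longrightarrow> norm (h z) \<le> norm (h w)"
    using continuous_attains_sup[of "cball 0 R" "\<lambda>z. norm (h z)"] True by auto
  let ?q = "norm (h w)"
  have q1: "?q < 1" using w(1) assms by (intro norm_h_less) auto
  have "norm ((K ^^ n) z) \<le> ?q ^ n * norm z" if z: "norm z \<le> R" for z n
  proof (induction n)
    case (Suc n)
    have "?q ^ n * norm z \<le> 1 * norm z" using q1 by (intro mult_right_mono power_le_one) auto
    then have n: "norm ((K ^^ n) z) \<le> R" using Suc z by simp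
    have "norm ((K ^^ Suc n) z) = norm ((K ^^ n) z) * norm (h ((K ^^ n) z))"
      using h(2)[of "(K ^^ n) z"] n assms by (simp add: norm_mult)
    also have "\<dots> \<le> (?q ^ n * norm z) * ?q"
      using Suc w(2) n by (intro mult_mono) auto
    finally show ?case by (simp add: mult_ac)
  qed simp
  then show ?thesis using that q1 by (metis norm_ge_zero)
next
  case False
  show ?thesis
  proof (rule that[of 0])
    fix z :: complex and n assume "norm z \<le> R"
    then show "norm ((K ^^ n) z) \<le> 0 ^ n * norm z" using False norm_ge_zero[of z] by linarith
  qed auto
qed

lemma iter_tendsto_0:
  assumes "norm z < 1" shows "(\<lambda>n. (K ^^ n) z) \<longlonglongrightarrow> 0"
proof -
  obtain q where q: "0 \<le> q" "q < 1" "\<And>w n. norm w \<le> norm z \<Longrightarrow> norm ((K ^^ n) w) \<le> q ^ n * norm w"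
    using iter_geometric[OF assms] by blast
  have "(\<lambda>n. q ^ n * norm z) \<longlonglongrightarrow> 0 * norm z"
    by (intro tendsto_intros LIMSEQ_power_zero) (use q in auto)
  then show ?thesis
    using Lim_null_comparison[OF always_eventually[OF allI[OF q(3)[of z]]]] by simp
qed

section \<open>The Koenigs function as an infinite product\<close>

definition P where "P z = lim (\<lambda>n. \<Prod>k<n. h ((K ^^ k) z) / \<kappa>)"

text \<open>As \<open>h - \<kappa>\<close> vanishes at \<open>0\<close>, the distance of the factors
  from \<open>1\<close> is bounded by a multiple of the modulus of the iterates. This decays
  geometrically, so the product converges by the M-test.\<close>

lemma uniform_limit_P:
  assumes R: "R < 1"
  shows "uniform_limit (cball 0 R) (\<lambda>n z. \<Prod>k<n. h ((K ^^ k) z) / \<kappa>) P sequentially"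
proof -
  obtain q where q: "0 \<le> q" "q < 1" "\<And>z n. norm z \<le> R \<Longrightarrow> norm ((K ^^ n) z) \<le> q ^ n * norm z"
    using iter_geometric[OF R] by blast
  have "(\<lambda>z. h z - \<kappa>) holomorphic_on unit_disc" "(\<lambda>z. h z - \<kappa>) 0 = 0"
    using h by (auto intro!: holomorphic_intros)
  from Schwarz3[OF this] obtain h2 where h2: "h2 holomorphic_on unit_disc"
    "\<And>z. norm z < 1 \<Longrightarrow> h z - \<kappa> = z * h2 z" by metis
  have "continuous_on (cball 0 R) h2"
    using R by (intro holomorphic_on_imp_continuous_on holomorphic_on_subset[OF h2(1)]) auto
  then have "bounded (h2 ` cball 0 R)"
    by (intro compact_imp_bounded compact_continuous_image compact_cball)
  then obtain B where B: "\<And>z. norm z \<le> R \<Longrightarrow> norm (h2 z) \<le> B"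
    unfolding bounded_iff by force
  define C where "C = B * R / norm \<kappa>"
  have bd: "norm (h ((K ^^ n) z) / \<kappa> - 1) \<le> C * q ^ n" if z: "z \<in> cball 0 R" for n z
  proof -
    have zR: "norm z \<le> R" using z by simp
    have R0: "0 \<le> R" using zR norm_ge_zero[of z] by linarith
    have 1: "norm ((K ^^ n) z) \<le> q ^ n * R"
      using q(3)[OF zR, of n] mult_left_mono[OF zR, of "q ^ n"] q(1) by simp
    moreover have "q ^ n * R \<le> 1 * R" using q R0 by (intro mult_right_mono power_le_one) auto
    ultimately have 2: "norm ((K ^^ n) z) \<le> R" by simp
    have "norm (h ((K ^^ n) z) / \<kappa> - 1) = norm (h ((K ^^ n) z) - \<kappa>) / norm \<kappa>"
      using lam by (simp add: norm_divide[symmetric] diff_divide_distrib)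
    also have "h ((K ^^ n) z) - \<kappa> = (K ^^ n) z * h2 ((K ^^ n) z)"
      using 2 R by (intro h2) auto
    also have "norm \<dots> / norm \<kappa> \<le> (q ^ n * R) * B / norm \<kappa>"
      unfolding norm_mult using 1 B[OF 2] q R0 by (intro divide_right_mono mult_mono) auto
    finally show ?thesis by (simp add: C_def mult_ac)
  qed
  have "uniformly_convergent_on (cball 0 R) (\<lambda>n z. \<Prod>k<n. h ((K ^^ k) z) / \<kappa>)"
  proof (rule uniformly_convergent_on_prod')
    fix n
    have "(\<lambda>z. h ((K ^^ n) z) / \<kappa>) holomorphic_on unit_disc"
      by (intro holomorphic_intros hol_h_iter lam(2))
    then show "continuous_on (cball 0 R) (\<lambda>z. h ((K ^^ n) z) / \<kappa>)"
      using R by (intro holomorphic_on_imp_continuous_on, elim holomorphic_on_subset) auto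
  next
    show "uniformly_convergent_on (cball 0 R) (\<lambda>N z. \<Sum>n<N. norm (h ((K ^^ n) z) / \<kappa> - 1))"
      by (rule Weierstrass_m_test'[where M = "\<lambda>n. C * q ^ n"])
         (use bd q in \<open>auto intro!: summable_mult summable_geometric\<close>)
  qed simp
  then show ?thesis
    by (simp add: uniformly_convergent_uniform_limit_iff P_def[abs_def])
qed

text \<open>The Koenigs function, the limit of \<open>(K ^^ n) z / \<kappa> ^ n\<close>.\<close>
definition \<sigma> where "\<sigma> z = z * P z"

lemma iter_eq_prod:
  assumes "norm z < 1" shows "(K ^^ n) z / \<kappa> ^ n = z * (\<Prod>k<n. h ((K ^^ k) z) / \<kappa>)"
proof (induction n)
  case (Suc n)
  have "(K ^^ Suc n) z / \<kappa> ^ Suc n = ((K ^^ n) z / \<kappa> ^ n) * (h ((K ^^ n) z) / \<kappa>)"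
    using h(2)[OF iter_maps[OF assms, of n]] by simp
  then show ?case using Suc by simp
qed simp

lemma uniform_limit_\<sigma>:
  assumes R: "R < 1"
  shows "uniform_limit (cball 0 R) (\<lambda>n z. (K ^^ n) z / \<kappa> ^ n) \<sigma> sequentially"
proof -
  have "uniform_limit (cball 0 R) (\<lambda>n z. z * (\<Prod>k<n. h ((K ^^ k) z) / \<kappa>)) (\<lambda>z. z * P z) sequentially"
  proof (rule uniform_lim_mult)
    have "bounded (cball (0::complex) R)" by simp
    then show "bounded ((\<lambda>z::complex. z) ` cball 0 R)" by simp
    have "\<forall>\<^sub>F n in sequentially. continuous_on (cball 0 R) (\<lambda>z. \<Prod>k<n. h ((K ^^ k) z) / \<kappa>)"
    proof (intro always_eventually allI continuous_intros)
      fix k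
      show "continuous_on (cball 0 R) (\<lambda>z. h ((K ^^ k) z))"
        using R hol_h_iter[of k] by (intro holomorphic_on_imp_continuous_on, elim holomorphic_on_subset) auto
    qed (use lam in auto)
    then have "continuous_on (cball 0 R) P"
      by (rule uniform_limit_theorem[OF _ uniform_limit_P[OF R]]) simp
    then show "bounded (P ` cball 0 R)"
      by (intro compact_imp_bounded compact_continuous_image compact_cball)
  qed (use uniform_limit_P[OF R] in \<open>auto intro: uniform_limit_const\<close>)
  moreover have "uniform_limit (cball 0 R) (\<lambda>n z. (K ^^ n) z / \<kappa> ^ n) \<sigma> sequentially
    \<longleftrightarrow> uniform_limit (cball 0 R) (\<lambda>n z. z * (\<Prod>k<n. h ((K ^^ k) z) / \<kappa>)) (\<lambda>z. z * P z) sequentially"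
    by (rule uniform_limit_cong) (use R iter_eq_prod in \<open>auto simp: \<sigma>_def\<close>)
  ultimately show ?thesis by simp
qed

lemma tendsto_\<sigma>:
  assumes "norm z < 1" shows "(\<lambda>n. (K ^^ n) z / \<kappa> ^ n) \<longlonglongrightarrow> \<sigma> z"
  by (rule tendsto_uniform_limitI[OF uniform_limit_\<sigma>[OF assms]]) simp

text \<open>The factor \<open>2\<close> leaves room for Cauchy's estimate: convergence on radius
  \<open>2 * d\<close> gives convergence of derivatives on radius \<open>d\<close>.\<close>

lemma cball_in_unit_disc:
  assumes x: "norm (x::complex) < 1"
  obtains d R where "d > 0" "R < 1" "cball x (2 * d) \<subseteq> cball 0 R" "cball x (2 * d) \<subseteq> unit_disc"
proof -
  let ?d = "(1 - norm x) / 4" and ?R = "(1 + norm x) / 2"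
  have 1: "?d > 0" "?R < 1" using x by auto
  have 2: "cball x (2 * ?d) \<subseteq> cball 0 ?R"
    using x by (simp add: cball_subset_cball_iff dist_norm field_simps)
  also have "\<dots> \<subseteq> unit_disc" using 1 by auto
  finally show ?thesis using that[OF 1 2] by blast
qed

lemma hol_P: "P holomorphic_on unit_disc"
proof (rule holomorphic_uniform_sequence)
  show "(\<lambda>z. \<Prod>k<n. h ((K ^^ k) z) / \<kappa>) holomorphic_on unit_disc" for n
    by (intro holomorphic_intros hol_h_iter lam(2))
next
  fix x assume "x \<in> unit_disc"
  then obtain d R where "d > 0" "R < 1" "cball x (2 * d) \<subseteq> cball 0 R" "cball x (2 * d) \<subseteq> unit_disc"
    using cball_in_unit_disc[of x] by auto
  then show "\<exists>d>0. cball x d \<subseteq> unit_disc \<and> uniform_limit (cball x d) (\<lambda>n z. \<Prod>k<n. h ((K ^^ k) z) / \<kappa>) P sequentially"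
    by (intro exI[of _ "2 * d"]) (auto intro: uniform_limit_on_subset[OF uniform_limit_P])
qed simp

lemma P_0: "P 0 = 1"
  using lam(2) by (simp add: P_def h(3))

section \<open>Normalization, functional equation and critical points of
  \<open>\<sigma>\<close>\<close>

lemma hol_\<sigma>: "\<sigma> holomorphic_on unit_disc"
  unfolding \<sigma>_def[abs_def] by (intro holomorphic_intros hol_P)

lemma \<sigma>_0 [simp]: "\<sigma> 0 = 0"
  by (simp add: \<sigma>_def)

lemma deriv_\<sigma>_0: "deriv \<sigma> 0 = 1"
proof -
  have "(P has_field_derivative deriv P 0) (at 0)"
    using hol_P by (intro holomorphic_derivI[of _ unit_disc]) auto
  then have "((\<lambda>z. z * P z) has_field_derivative 1) (at 0)"
    by (auto intro!: derivative_eq_intros simp: P_0)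
  then show ?thesis unfolding \<sigma>_def[abs_def] by (rule DERIV_imp_deriv)
qed

text \<open>\<open>T\<close> commutes with all iterates, so \<open>(K ^^ n) (T z)\<close> is
  \<open>(K ^^ n) z\<close> times \<open>t ((K ^^ n) z)\<close>, and this last factor tends to
  \<open>t 0 = deriv T 0\<close>. Stated for general \<open>T\<close>, it lets the function built
  from one member linearize a whole semigroup.\<close>

lemma \<sigma>_commute:
  assumes T: "T holomorphic_on unit_disc" "T 0 = 0" "\<And>z. norm z < 1 \<Longrightarrow> norm (T z) < 1"
    and comm: "\<And>z. norm z < 1 \<Longrightarrow> T (K z) = K (T z)" and z: "norm z < 1"
  shows "\<sigma> (T z) = deriv T 0 * \<sigma> z"
proof -
  obtain t where t: "t holomorphic_on unit_disc" "\<And>z. norm z < 1 \<Longrightarrow> T z = z * t z" "deriv T 0 = t 0"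
    using Schwarz3[OF T(1,2)] by metis
  have it: "(K ^^ n) (T z) = T ((K ^^ n) z)" for n
    by (induction n) (simp_all add: comm iter_maps z)
  have "isCont t 0"
    using t(1) holomorphic_on_imp_continuous_on continuous_on_eq_continuous_at[of unit_disc t] by auto
  then have "(\<lambda>n. t ((K ^^ n) z)) \<longlonglongrightarrow> t 0"
    by (rule isCont_tendsto_compose[OF _ iter_tendsto_0[OF z]])
  then have "(\<lambda>n. (K ^^ n) z / \<kappa> ^ n * t ((K ^^ n) z)) \<longlonglongrightarrow> \<sigma> z * t 0"
    by (intro tendsto_intros tendsto_\<sigma> z)
  moreover have "(\<lambda>n. (K ^^ n) z / \<kappa> ^ n * t ((K ^^ n) z)) = (\<lambda>n. (K ^^ n) (T z) / \<kappa> ^ n)"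
    using t(2)[OF iter_maps[OF z]] it by auto
  ultimately have "(\<lambda>n. (K ^^ n) (T z) / \<kappa> ^ n) \<longlonglongrightarrow> \<sigma> z * t 0" by simp
  then show ?thesis
    using LIMSEQ_unique[OF tendsto_\<sigma>[OF T(3)[OF z]]] t(3) by (simp add: mult.commute)
qed

lemma \<sigma>_K: "norm z < 1 \<Longrightarrow> \<sigma> (K z) = \<kappa> * \<sigma> z"
  using \<sigma>_commute[OF hol K0 maps] lam(1) by simp

lemma \<sigma>_iter: "norm z < 1 \<Longrightarrow> \<sigma> ((K ^^ n) z) = \<kappa> ^ n * \<sigma> z"
  by (induction n) (auto simp: \<sigma>_K iter_maps)

lemma deriv_iter_nz:
  assumes "\<And>z. norm z < 1 \<Longrightarrow> deriv K z \<noteq> 0" "norm z < 1"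
  shows "deriv (K ^^ n) z \<noteq> 0"
proof (induction n)
  case 0
  then show ?case by (simp add: id_def)
next
  case (Suc n)
  then show ?case
    unfolding deriv_iter_Suc[OF assms(2)] using assms iter_maps by simp
qed

text \<open>Differentiating \<open>\<sigma> ((K ^^ n) z) = \<kappa> ^ n * \<sigma> z\<close> carries
  a critical point along its orbit. The orbit tends to \<open>0\<close>, where the derivative of
  \<open>\<sigma>\<close> is \<open>1\<close>.\<close>

lemma deriv_\<sigma>_nz:
  assumes nz: "\<And>z. norm z < 1 \<Longrightarrow> deriv K z \<noteq> 0" and z: "norm z < 1"
  shows "deriv \<sigma> z \<noteq> 0"
proof
  assume 0: "deriv \<sigma> z = 0"
  have zero: "deriv \<sigma> ((K ^^ n) z) = 0" for n
  proof -
    have "deriv (\<sigma> \<circ> (K ^^ n)) z = deriv \<sigma> ((K ^^ n) z) * deriv (K ^^ n) z"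
      by (rule deriv_chain)
         (use z iter_maps iter_hol hol_\<sigma> in \<open>auto intro!: holomorphic_on_imp_differentiable_at[of _ unit_disc]\<close>)
    moreover have "deriv (\<sigma> \<circ> (K ^^ n)) z = deriv (\<lambda>w. \<kappa> ^ n * \<sigma> w) z"
      by (rule deriv_cong_ev)
         (use z \<sigma>_iter in \<open>auto intro!: eventually_mono[OF eventually_nhds_in_open[of unit_disc]]\<close>)
    moreover have "\<dots> = \<kappa> ^ n * deriv \<sigma> z"
      by (rule deriv_cmult) (use z hol_\<sigma> in \<open>auto intro!: holomorphic_on_imp_differentiable_at[of _ unit_disc]\<close>)
    ultimately show ?thesis using 0 deriv_iter_nz[OF nz z] by simp
  qed
  have "isCont (deriv \<sigma>) 0"
    using holomorphic_on_imp_continuous_on[OF holomorphic_deriv[OF hol_\<sigma> open_ball]]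
      continuous_on_eq_continuous_at[OF open_ball, of "0::complex" 1 "deriv \<sigma>"] by auto
  then have "(\<lambda>n. deriv \<sigma> ((K ^^ n) z)) \<longlonglongrightarrow> deriv \<sigma> 0"
    by (rule isCont_tendsto_compose[OF _ iter_tendsto_0[OF z]])
  then show False by (simp add: zero deriv_\<sigma>_0 LIMSEQ_const_iff)
qed

text \<open>Dividing numerator and denominator by \<open>\<kappa> ^ n\<close> does not change the
  quotient and makes both converge; a positive lower bound of \<open>norm (deriv \<sigma> w)\<close>
  on the smaller disc then permits the division of limits.\<close>

lemma locally_uniform_limit_generator:
  assumes nz: "\<And>z. norm z < 1 \<Longrightarrow> deriv K z \<noteq> 0"
  shows "locally_uniform_limit unit_disc (\<lambda>n z. - ((K ^^ n) z / deriv (K ^^ n) z)) (\<lambda>z. - (\<sigma> z / deriv \<sigma> z))"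
  unfolding locally_uniform_limit_def
proof
  fix z assume "z \<in> unit_disc"
  then obtain d R where d: "d > 0" "R < 1" "cball z (2 * d) \<subseteq> cball 0 R" "cball z (2 * d) \<subseteq> unit_disc"
    using cball_in_unit_disc[of z] by auto
  have sub: "cball z d \<subseteq> cball z (2 * d)" using d by auto
  let ?S = "\<lambda>n z. (K ^^ n) z / \<kappa> ^ n"
  have S: "uniform_limit (cball z (2 * d)) ?S \<sigma> sequentially"
    by (rule uniform_limit_on_subset[OF uniform_limit_\<sigma>[OF d(2)] d(3)])
  have S': "uniform_limit (cball z d) (\<lambda>n. deriv (?S n)) (deriv \<sigma>) sequentially"
  proof (rule uniform_limit_deriv[OF open_ball _ hol_\<sigma> S _ d(4,1)])
    show "?S n holomorphic_on unit_disc" for n using lam by (intro holomorphic_intros iter_hol) auto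
    show "cball w d \<subseteq> cball z (2 * d)" if "w \<in> cball z d" for w
      using that d by (auto simp: cball_subset_cball_iff dist_commute)
  qed
  have cd: "continuous_on (cball z d) (\<lambda>w. norm (deriv \<sigma> w))"
    using sub d(4) by (intro continuous_intros holomorphic_on_imp_continuous_on holomorphic_on_subset[OF holomorphic_deriv[OF hol_\<sigma>]]) auto
  then obtain m where m: "m \<in> cball z d" "\<And>w. w \<in> cball z d \<Longrightarrow> norm (deriv \<sigma> m) \<le> norm (deriv \<sigma> w)"
    using continuous_attains_inf[OF compact_cball _ cd] d by auto
  have "m \<in> unit_disc" using m(1) sub d(4) by blast
  then have mp: "norm (deriv \<sigma> m) > 0" using deriv_\<sigma>_nz[OF nz] by auto
  have "continuous_on (cball z d) \<sigma>"
    using sub d(4) by (intro holomorphic_on_imp_continuous_on holomorphic_on_subset[OF hol_\<sigma>]) auto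
  then have b: "bounded (\<sigma> ` cball z d)"
    by (intro compact_imp_bounded compact_continuous_image compact_cball)
  have "uniform_limit (cball z d) (\<lambda>n w. - (?S n w / deriv (?S n) w)) (\<lambda>w. - (\<sigma> w / deriv \<sigma> w)) sequentially"
    by (rule uniform_limit_uminus[OF uniform_lim_divide[OF uniform_limit_on_subset[OF S sub] S' b m(2) mp]])
  moreover have "uniform_limit (cball z d) (\<lambda>n w. - (?S n w / deriv (?S n) w)) (\<lambda>w. - (\<sigma> w / deriv \<sigma> w)) sequentially
    \<longleftrightarrow> uniform_limit (cball z d) (\<lambda>n w. - ((K ^^ n) w / deriv (K ^^ n) w)) (\<lambda>w. - (\<sigma> w / deriv \<sigma> w)) sequentially"
  proof (rule uniform_limit_cong[OF always_eventually], intro allI ballI)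
    fix n w assume "w \<in> cball z d"
    then have "w \<in> unit_disc" using sub d(4) by blast
    then have "(K ^^ n) field_differentiable at w"
      by (intro holomorphic_on_imp_differentiable_at[OF iter_hol]) auto
    then have "deriv (?S n) w = deriv (K ^^ n) w / \<kappa> ^ n"
      by (rule deriv_cdivide_right)
    then show "- (?S n w / deriv (?S n) w) = - ((K ^^ n) w / deriv (K ^^ n) w)"
      using lam by simp
  qed simp
  ultimately have "uniform_limit (cball z d) (\<lambda>n w. - ((K ^^ n) w / deriv (K ^^ n) w)) (\<lambda>w. - (\<sigma> w / deriv \<sigma> w)) sequentially"
    by simp
  then show "\<exists>r>0. ball z r \<subseteq> unit_disc \<and> uniform_limit (ball z r) (\<lambda>n z. - ((K ^^ n) z / deriv (K ^^ n) z)) (\<lambda>z. - (\<sigma> z / deriv \<sigma> z)) sequentially"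
    using d sub by (intro exI[of _ d]) (auto intro: uniform_limit_on_subset)
qed

end

section \<open>The K-transforms of a semigroup\<close>

text \<open>Surjectivity and injectivity of the K-transform are the existence and uniqueness behind
  \<open>THE\<close>.\<close>

lemma monotone_conv:
  assumes \<mu>: "circle_prob \<mu>" and \<nu>: "circle_prob \<nu>"
  shows "circle_prob (\<mu> \<rhd> \<nu>)"
    and "z \<in> unit_disc \<Longrightarrow> K_transform (\<mu> \<rhd> \<nu>) z = K_transform \<mu> (K_transform \<nu> z)"
proof -
  let ?K = "\<lambda>z. K_transform \<mu> (K_transform \<nu> z)"
  have "(K_transform \<mu> \<circ> K_transform \<nu>) holomorphic_on unit_disc"
    by (rule holomorphic_on_compose_gen[OF holomorphic_K_transform[OF \<nu>] holomorphic_K_transform[OF \<mu>]])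
       (use K_transform_maps_disc[OF \<nu>] in auto)
  then have hol: "?K holomorphic_on unit_disc" by (simp add: o_def)
  obtain \<rho> where \<rho>: "circle_prob \<rho>" "\<And>z. z \<in> unit_disc \<Longrightarrow> K_transform \<rho> z = ?K z"
    using K_transform_surj[OF hol] K_transform_maps_disc \<mu> \<nu> by auto
  have "\<exists>!\<rho>. circle_prob \<rho> \<and> (\<forall>z\<in>unit_disc. K_transform \<rho> z = ?K z)"
  proof (rule ex1I[of _ \<rho>])
    fix \<rho>' assume "circle_prob \<rho>' \<and> (\<forall>z\<in>unit_disc. K_transform \<rho>' z = ?K z)"
    then show "\<rho>' = \<rho>" using \<rho> by (intro K_transform_inject) auto
  qed (use \<rho> in auto)
  from theI'[OF this, folded monotone_conv_def]
  show "circle_prob (\<mu> \<rhd> \<nu>)" "z \<in> unit_disc \<Longrightarrow> K_transform (\<mu> \<rhd> \<nu>) z = ?K z" by auto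
qed

lemma monotone_conv_eqI:
  assumes "circle_prob \<mu>" "circle_prob \<nu>" "circle_prob \<rho>"
    and "\<And>z. z \<in> unit_disc \<Longrightarrow> K_transform \<rho> z = K_transform \<mu> (K_transform \<nu> z)"
  shows "\<mu> \<rhd> \<nu> = \<rho>"
  using assms monotone_conv by (intro K_transform_inject) auto

text \<open>Modulus \<open>1\<close> is the equality case of Schwarz' lemma, where the K-transform
  is a rotation by some \<open>c\<close>, and this belongs to the Dirac measure at
  \<open>c\<close>.\<close>

lemma norm_deriv_K_transform_less_1:
  assumes \<mu>: "circle_prob \<mu>" and nondeg: "\<not> (\<exists>\<xi>\<in>unit_circle. measure \<mu> {\<xi>} = 1)"
  shows "norm (deriv (K_transform \<mu>) 0) < 1"
proof (rule ccontr)
  note S = Schwarz_Lemma[OF holomorphic_K_transform[OF \<mu>] K_transform_0 K_transform_maps_disc[OF \<mu>]]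
  assume "\<not> ?thesis"
  moreover have "norm (deriv (K_transform \<mu>) 0) \<le> 1" using S(2)[of 0] by simp
  ultimately obtain c where c: "\<And>z. norm z < 1 \<Longrightarrow> K_transform \<mu> z = c * z" "norm c = 1"
    using S(3)[of 0] by force
  have "\<mu> = return circle_borel c"
    using c circle_prob_return[OF c(2)] \<mu> by (intro K_transform_inject) (auto simp: K_transform_return)
  moreover have "measure (return circle_borel c) {c} = 1"
    using c(2) by (subst measure_return) (auto simp: circle_borel_def sets_restrict_space)
  ultimately show False using nondeg c(2) by auto
qed

text \<open>Integrating \<open>l (s + t) = l s * l t\<close> over \<open>t\<close> in
  \<open>{0..c}\<close> expresses \<open>l\<close> by its own primitive, which supplies the missing
  smoothness.\<close>

lemma continuous_multiplicative_imp_exp: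
  fixes l :: "real \<Rightarrow> complex"
  assumes cont: "continuous_on {0..} l" and l0: "l 0 = 1"
    and mult: "\<And>s t. s \<ge> 0 \<Longrightarrow> t \<ge> 0 \<Longrightarrow> l (s + t) = l s * l t"
  obtains a where "\<And>s. s \<ge> 0 \<Longrightarrow> l s = exp (- (of_real s * a))"
proof -
  define \<Phi> where "\<Phi> x = integral {0..x} l" for x
  have int: "l integrable_on {x..y}" if "0 \<le> x" for x y
    using that by (intro integrable_continuous_real continuous_on_subset[OF cont]) auto
  have D\<Phi>: "(\<Phi> has_vector_derivative l x) (at x within {0..T})" if "x \<in> {0..T}" for x T
    unfolding \<Phi>_def using that
    by (intro integral_has_vector_derivative continuous_on_subset[OF cont]) auto
  \<comment> \<open>A primitive that is zero on \<open>{0..1}\<close> would have derivative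
    \<open>0\<close> at \<open>0\<close>, but this derivative is \<open>l 0 = 1\<close>.\<close>
  have "\<exists>c>0. \<Phi> c \<noteq> 0"
  proof (rule ccontr)
    assume "\<not> (\<exists>c>0. \<Phi> c \<noteq> 0)"
    then have z: "\<Phi> x = 0" if "x \<in> {0..1}" for x
      using that by (cases "x = 0") (auto simp: \<Phi>_def)
    have "((\<lambda>x. 0) has_vector_derivative l 0) (at 0 within {0..1})"
      by (rule has_vector_derivative_transform[OF _ _ D\<Phi>[of 0 1]]) (use z in auto)
    moreover have "((\<lambda>x. 0) has_vector_derivative 0) (at (0::real) within {0..1})"
      by simp
    ultimately have "l 0 = 0"
      by (rule vector_derivative_unique_within[rotated]) (auto simp: at_within_Icc_at_right)
    then show False using l0 by simp
  qed
  then obtain c where c: "c > 0" "\<Phi> c \<noteq> 0" by blast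
  have eq: "l s = (\<Phi> (s + c) - \<Phi> s) / \<Phi> c" if s: "s \<ge> 0" for s
  proof -
    have "l s * \<Phi> c = integral {0..c} (\<lambda>t. l s * l t)"
      unfolding \<Phi>_def by simp
    also have "\<dots> = integral {0..c} (\<lambda>t. l (t + s))"
      using s by (intro integral_cong) (simp add: mult[symmetric] add.commute)
    also have "\<dots> = integral {s..s + c} l"
    proof -
      have "(l has_integral integral {s..s + c} l) (cbox s (s + c))"
        using integrable_integral[OF int[OF s]] by simp
      from has_integral_affinity[OF this, of 1 s] show ?thesis
        by (simp add: integral_unique)
    qed
    also have "\<dots> = \<Phi> (s + c) - \<Phi> s"
      unfolding \<Phi>_def using s c Henstock_Kurzweil_Integration.integral_combine[OF _ _ int[of 0 "s + c"], of s]
      by (simp add: algebra_simps)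
    finally show ?thesis using c by (simp add: field_simps)
  qed
  text \<open>By \<open>eq\<close>, continuity of \<open>l\<close> makes it differentiable with \<open>l' = b * l\<close>.\<close>
  define b where "b = (l c - 1) / \<Phi> c"
  have Dl: "(l has_vector_derivative b * l x) (at x within {0..T})" if x: "x \<in> {0..T}" for x T
  proof -
    have "((\<Phi> \<circ> (\<lambda>s. s + c)) has_vector_derivative (1 *\<^sub>R l (x + c))) (at x within {0..T})"
    proof (rule vector_diff_chain_within)
      show "((\<lambda>s. s + c) has_vector_derivative 1) (at x within {0..T})"
        by (auto intro!: derivative_eq_intros)
      show "(\<Phi> has_vector_derivative l (x + c)) (at (x + c) within (\<lambda>s. s + c) ` {0..T})"
        using x c by (intro has_vector_derivative_within_subset[OF D\<Phi>[of "x + c" "T + c"]]) auto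
    qed
    then have "((\<lambda>s. (\<Phi> (s + c) - \<Phi> s) / \<Phi> c) has_vector_derivative (l (x + c) - l x) / \<Phi> c) (at x within {0..T})"
      using D\<Phi>[OF x] by (auto intro!: derivative_eq_intros simp: o_def)
    moreover have "(l (x + c) - l x) / \<Phi> c = b * l x"
      using mult[of x c] x c by (simp add: b_def field_simps)
    ultimately show ?thesis
      by (auto intro: has_vector_derivative_transform[OF x] simp: eq)
  qed
  have "l s = exp (- (of_real s * (- b)))" if s: "s \<ge> 0" for s
  proof -
    have "((\<lambda>x. l x * exp (- (of_real x * b))) has_vector_derivative 0) (at x within {0..s})" if "x \<in> {0..s}" for x
    proof -
      have "((\<lambda>x. exp (- (of_real x * b))) has_vector_derivative - b * exp (- (of_real x * b))) (at x within {0..s})"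
        by (rule has_vector_derivative_real_field[of "\<lambda>x. exp (- (x * b))" _ _ _])
           (auto intro!: derivative_eq_intros)
      from has_vector_derivative_mult[OF Dl[OF that] this] show ?thesis
        by (simp add: algebra_simps)
    qed
    then obtain k where k: "\<And>x. x \<in> {0..s} \<Longrightarrow> l x * exp (- (of_real x * b)) = k"
      using has_derivative_zero_constant[of "{0..s}" "\<lambda>x. l x * exp (- (of_real x * b))"]
      by (auto simp: has_vector_derivative_def)
    have "l s * exp (- (of_real s * b)) = 1"
      using k[of 0] k[of s] s l0 by simp
    then show ?thesis by (simp add: exp_minus field_simps)
  qed
  then show ?thesis using that by blast
qed

locale K_semigroup =
  fixes M :: "real \<Rightarrow> complex measure"
  assumes semigroup: "monotone_conv_semigroup M"
begin

lemma prob: "t \<ge> 0 \<Longrightarrow> circle_prob (M t)"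
  using semigroup by (simp add: monotone_conv_semigroup_def)

lemma M_0: "M 0 = return circle_borel 1"
  using semigroup by (simp add: monotone_conv_semigroup_def)

lemma K_add:
  assumes "s \<ge> 0" "t \<ge> 0" "norm z < 1"
  shows "K_transform (M (s + t)) z = K_transform (M s) (K_transform (M t) z)"
proof -
  have "M s \<rhd> M t = M (s + t)"
    using semigroup assms by (simp add: monotone_conv_semigroup_def)
  then show ?thesis using monotone_conv(2)[OF prob prob, of s t z] assms by simp
qed

lemma maps: "t \<ge> 0 \<Longrightarrow> norm z < 1 \<Longrightarrow> norm (K_transform (M t) z) < 1"
  by (intro K_transform_maps_disc prob)

lemma hol: "t \<ge> 0 \<Longrightarrow> K_transform (M t) holomorphic_on unit_disc"
  by (intro holomorphic_K_transform prob)

lemma norm_K_le: "t \<ge> 0 \<Longrightarrow> norm z < 1 \<Longrightarrow> norm (K_transform (M t) z) \<le> norm z"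
  by (rule Schwarz_Lemma(1)[OF hol K_transform_0 maps]) auto

lemma continuous_integral:
  fixes f :: "complex \<Rightarrow> complex"
  assumes f: "continuous_on unit_circle f"
  shows "continuous_on {0..} (\<lambda>t. \<integral>x. f x \<partial>M t)"
proof -
  have w: "weakly_continuous_family M"
    using semigroup by (simp add: monotone_conv_semigroup_def)
  have "continuous_on {0..} (\<lambda>t. Complex (\<integral>x. Re (f x) \<partial>M t) (\<integral>x. Im (f x) \<partial>M t))"
    using w f unfolding weakly_continuous_family_def
    by (intro continuous_on_Complex) (auto intro!: continuous_intros)
  then show ?thesis
  proof (rule continuous_on_eq)
    fix t :: real assume t: "t \<in> {0..}"
    have "integrable (M t) f" using t by (intro integrable_circle_prob[OF prob f]) auto
    then show "Complex (\<integral>x. Re (f x) \<partial>M t) (\<integral>x. Im (f x) \<partial>M t) = (\<integral>x. f x \<partial>M t)"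
      by (simp add: complex_eq_iff)
  qed
qed

lemma continuous_K:
  assumes "norm z < 1" shows "continuous_on {0..} (\<lambda>t. K_transform (M t) z)"
  unfolding K_transform_def using norm_divide_one_plus_less_1(1)[OF Re_psi_transform_gt[OF prob assms]]
  by (intro continuous_intros) (auto simp: psi_transform_def intro!: continuous_integral continuous_on_psi_kernel assms)

text \<open>A single test function suffices: \<open>norm (x - 1)\<close> has integral
  \<open>0\<close> at time \<open>0\<close>, and \<open>norm (x - 1) / (1 - R)^2\<close> bounds the
  difference of the kernels at \<open>x\<close> and \<open>1\<close> for all \<open>z\<close> in the
  disc at once.\<close>

lemma K_uniformly_near_id:
  fixes R e :: real
  assumes R: "R < 1" and e: "e > 0"
  obtains \<delta> where "\<delta> > 0" "\<And>s (z::complex). 0 \<le> s \<Longrightarrow> s < \<delta> \<Longrightarrow> norm z \<le> R \<Longrightarrow> norm (K_transform (M s) z - z) \<le> e"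
proof -
  let ?d = "\<lambda>s. \<integral>x. norm (x - 1) \<partial>M s"
  have dc: "continuous_on unit_circle (\<lambda>x::complex. norm (x - 1))" by (intro continuous_intros)
  have "continuous_on {0..} ?d"
    using semigroup dc unfolding monotone_conv_semigroup_def weakly_continuous_family_def by blast
  moreover have "?d 0 = 0"
    unfolding M_0
    by (subst integral_return)
       (auto simp: circle_borel_def space_restrict_space intro!: borel_measurable_continuous_on_restrict continuous_intros)
  ultimately have "(?d \<longlongrightarrow> 0) (at 0 within {0..})"
    unfolding continuous_on_def by (metis atLeast_iff order_refl)
  \<comment> \<open>The square absorbs the kernel bound. The \<open>4\<close> pays for the passage
    from \<open>psi_transform\<close> to the K-transform: \<open>norm (1 - z) \<le> 2\<close>, and
    \<open>1 + psi_transform (M s) z\<close> has modulus at least \<open>1 / 2\<close>.\<close>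
  moreover have "e * (1 - R)^2 / 4 > 0" using R e by simp
  ultimately have "\<forall>\<^sub>F s in at 0 within {0..}. ?d s < e * (1 - R)^2 / 4"
    by (rule order_tendstoD(2))
  then obtain \<delta> where \<delta>: "\<delta> > 0" "\<And>s. s \<in> {0..} \<Longrightarrow> s \<noteq> 0 \<Longrightarrow> dist s 0 < \<delta> \<Longrightarrow> ?d s < e * (1 - R)^2 / 4"
    unfolding eventually_at by blast
  show ?thesis
  proof (rule that[OF \<delta>(1)])
    fix s :: real and z :: complex assume s: "0 \<le> s" "s < \<delta>" and zR: "norm z \<le> R"
    have ds: "?d s \<le> e * (1 - R)^2 / 4"
      using \<delta>(2)[of s] s \<open>?d 0 = 0\<close> \<open>e * (1 - R)^2 / 4 > 0\<close> by (cases "s = 0") auto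
    have z: "norm z < 1" using zR R by simp
    interpret prob_space "M s" using prob[OF s(1)] by (simp add: circle_prob_def)
    have nz: "1 - z * x \<noteq> 0" "1 - R \<le> norm (1 - z * x)" if "norm x = 1" for x
      using one_minus_mult_circle[OF z that] zR by auto
    have ik: "integrable (M s) (\<lambda>x. z * x / (1 - z * x))"
      by (rule integrable_circle_prob[OF prob[OF s(1)] continuous_on_psi_kernel[OF z]])
    have "psi_transform (M s) z - z / (1 - z) = (\<integral>x. z * x / (1 - z * x) - z / (1 - z) \<partial>M s)"
      unfolding psi_transform_def using ik by (simp add: prob_space)
    also have "norm \<dots> \<le> (\<integral>x. norm (z * x / (1 - z * x) - z / (1 - z)) \<partial>M s)"
      by (rule integral_norm_bound)
    also have "\<dots> \<le> (\<integral>x. norm (x - 1) / (1 - R)^2 \<partial>M s)"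
    proof (rule integral_mono)
      show "integrable (M s) (\<lambda>x. norm (z * x / (1 - z * x) - z / (1 - z)))" using ik by simp
      show "integrable (M s) (\<lambda>x. norm (x - 1) / (1 - R)^2)"
        by (intro integrable_circle_prob[OF prob[OF s(1)]] continuous_intros) (use R in auto)
      fix x assume "x \<in> space (M s)"
      then have x: "norm x = 1" using space_circle_prob[OF prob[OF s(1)]] by simp
      have "z * x / (1 - z * x) - z / (1 - z) = z * (x - 1) / ((1 - z * x) * (1 - z))"
        using nz[OF x] nz[of 1] by (simp add: field_simps)
      also have "norm \<dots> = norm z * norm (x - 1) / (norm (1 - z * x) * norm (1 - z))"
        by (simp add: norm_mult norm_divide)
      also have "\<dots> \<le> 1 * norm (x - 1) / ((1 - R) * (1 - R))"
        using nz[OF x] nz[of 1] z R by (intro frac_le mult_mono mult_right_mono) auto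
      finally show "norm (z * x / (1 - z * x) - z / (1 - z)) \<le> norm (x - 1) / (1 - R)^2"
        by (simp add: power2_eq_square)
    qed
    also have "\<dots> = ?d s / (1 - R)^2" by simp
    also have "\<dots> \<le> e / 4" using ds R by (simp add: field_simps)
    finally have psi: "norm (psi_transform (M s) z - z / (1 - z)) \<le> e / 4" .
    have half: "1 / 2 \<le> norm (1 + psi_transform (M s) z)"
      using Re_psi_transform_gt[OF prob[OF s(1)] z] complex_Re_le_cmod[of "1 + psi_transform (M s) z"] by simp
    have z1: "1 - z \<noteq> 0" "norm (1 - z) \<le> 2"
      using nz[of 1] norm_triangle_ineq4[of 1 z] z by auto
    have "K_transform (M s) z - z = (psi_transform (M s) z - z / (1 - z)) * (1 - z) / (1 + psi_transform (M s) z)"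
    proof -
      have "(psi_transform (M s) z - z / (1 - z)) * (1 - z) = psi_transform (M s) z - z * (1 + psi_transform (M s) z)"
        using z1 by (simp add: field_simps)
      moreover have "1 + psi_transform (M s) z \<noteq> 0" using half by auto
      ultimately show ?thesis by (simp add: K_transform_def diff_divide_distrib)
    qed
    also have "norm \<dots> \<le> (e / 4 * 2) / (1 / 2)"
      unfolding norm_divide norm_mult using psi half z1 e by (intro frac_le mult_mono) auto
    finally show "norm (K_transform (M s) z - z) \<le> e" by simp
  qed
qed

lemma deriv_K_add:
  assumes "s \<ge> 0" "t \<ge> 0" "norm z < 1"
  shows "deriv (K_transform (M (s + t))) z
    = deriv (K_transform (M s)) (K_transform (M t) z) * deriv (K_transform (M t)) z"
proof -
  have "deriv (K_transform (M (s + t))) z = deriv (K_transform (M s) \<circ> K_transform (M t)) z"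
    by (rule deriv_cong_ev)
       (use assms K_add in \<open>auto intro!: eventually_mono[OF eventually_nhds_in_open[of unit_disc]]\<close>)
  also have "\<dots> = deriv (K_transform (M s)) (K_transform (M t) z) * deriv (K_transform (M t)) z"
    by (rule deriv_chain)
       (use assms maps hol in \<open>auto intro!: holomorphic_on_imp_differentiable_at[of _ unit_disc]\<close>)
  finally show ?thesis .
qed

text \<open>For small times the map is within \<open>r / 2\<close> of the identity on a disc, so by
  Cauchy's estimate its derivative is within \<open>1 / 2\<close> of \<open>1\<close>. A longer time
  is cut into equal small steps; the orbit of \<open>z\<close> never leaves the disc of radius
  \<open>norm z\<close>, and the chain rule multiplies nonzero factors.\<close>

lemma deriv_K_nz:
  assumes t: "t \<ge> 0" and z: "norm z < 1"
  shows "deriv (K_transform (M t)) z \<noteq> 0"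
proof -
  define R where "R = norm z"
  define r where "r = (1 - R) / 2"
  have r: "r > 0" "R + r < 1" using z by (auto simp: r_def R_def field_simps)
  obtain \<delta> where \<delta>: "\<delta> > 0"
    "\<And>s w. 0 \<le> s \<Longrightarrow> s < \<delta> \<Longrightarrow> norm w \<le> R + r \<Longrightarrow> norm (K_transform (M s) w - w) \<le> r / 2"
    using K_uniformly_near_id[OF r(2), of "r / 2"] r(1) by auto
  have small: "deriv (K_transform (M s)) w \<noteq> 0" if s: "0 \<le> s" "s < \<delta>" and w: "norm w \<le> R" for s w
  proof -
    have w1: "w \<in> unit_disc" using w r by simp
    have sub: "norm x \<le> R + r" if "x \<in> cball w r" for x
      using that w norm_triangle_ineq2[of x w] by (simp add: dist_norm norm_minus_commute)
    have "norm (deriv (\<lambda>w. K_transform (M s) w - w) w) \<le> (r / 2) / r"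
    proof (rule norm_deriv_le[of _ unit_disc])
      show "cball w r \<subseteq> unit_disc" using sub r by force
      show "norm (K_transform (M s) x - x) \<le> r / 2" if "x \<in> cball w r" for x
        using \<delta>(2)[OF s sub[OF that]] .
    qed (use r hol[OF s(1)] in \<open>auto intro!: holomorphic_intros\<close>)
    also have "deriv (\<lambda>w. K_transform (M s) w - w) w = deriv (K_transform (M s)) w - 1"
      using holomorphic_on_imp_differentiable_at[OF hol[OF s(1)] open_ball w1]
      by (subst deriv_diff) auto
    finally show ?thesis using r by auto
  qed
  obtain n :: nat where n: "t / \<delta> < real n" using reals_Archimedean2 by blast
  then have n0: "n > 0" using t \<delta>(1) by (cases n) (auto simp: field_simps)
  define s where "s = t / real n"
  have s: "0 \<le> s" "s < \<delta>" using t n n0 \<delta>(1) by (auto simp: s_def field_simps)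
  have "deriv (K_transform (M (real k * s))) z \<noteq> 0" for k
  proof (induction k)
    case 0
    then show ?case using small[of 0 z] \<delta>(1) by (simp add: R_def)
  next
    case (Suc k)
    have "norm (K_transform (M (real k * s)) z) \<le> R"
      using norm_K_le[of "real k * s" z] s z by (simp add: R_def)
    then have "deriv (K_transform (M (s + real k * s))) z \<noteq> 0"
      using Suc s small[OF s] z by (subst deriv_K_add) auto
    then show ?case by (simp add: algebra_simps)
  qed
  from this[of n] show ?thesis using n0 by (simp add: s_def)
qed

text \<open>The derivative at \<open>0\<close> is the first moment, hence continuous in time, and
  the chain rule at the common fixed point \<open>0\<close> makes it multiplicative.\<close>

lemma obtain_rate:
  obtains a where "\<And>s. s \<ge> 0 \<Longrightarrow> deriv (K_transform (M s)) 0 = exp (- (of_real s * a))"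
proof (rule continuous_multiplicative_imp_exp[of "\<lambda>s. deriv (K_transform (M s)) 0"])
  have "continuous_on {0..} (\<lambda>s. circle_moment (M s) 1)"
    unfolding circle_moment_def by (intro continuous_integral continuous_intros)
  then show "continuous_on {0..} (\<lambda>s. deriv (K_transform (M s)) 0)"
    by (rule continuous_on_eq) (simp add: deriv_K_transform_0 prob)
  have "circle_moment (M 0) 1 = 1"
    unfolding circle_moment_def M_0
    by (subst integral_return)
       (auto simp: circle_borel_def space_restrict_space intro!: borel_measurable_continuous_on_restrict continuous_intros)
  then show "deriv (K_transform (M 0)) 0 = 1"
    by (simp add: deriv_K_transform_0 prob)
qed (auto simp: deriv_K_add that)

end

section \<open>Spirallike functions and their flows\<close>

lemma exp_rate_add:
  fixes a :: complex
  shows "exp (- (of_real (s + t) * a)) = exp (- (of_real s * a)) * exp (- (of_real t * a))"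
  by (simp add: mult_exp_exp distrib_right)

lemma deriv_exp_line:
  fixes a c :: complex
  shows "((\<lambda>s. exp (- (of_real s * a)) * c) has_vector_derivative - a * (exp (- (of_real s * a)) * c)) (at s within S)"
proof -
  have "((\<lambda>x. exp (- (x * a)) * c) has_field_derivative - a * (exp (- (of_real s * a)) * c)) (at (of_real s))"
    by (auto intro!: derivative_eq_intros)
  then show ?thesis by (rule has_vector_derivative_real_field)
qed

text \<open>\<open>w s = g (exp (- a s) * \<sigma> z)\<close> solves \<open>w' = - w * u w\<close>.\<close>
lemma inverse_curve_derivative:
  fixes \<sigma> g :: "complex \<Rightarrow> complex"
  assumes U: "open U" and hol: "\<sigma> holomorphic_on U" and inj: "inj_on \<sigma> U"
    and g: "\<And>w. w \<in> U \<Longrightarrow> g (\<sigma> w) = w"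
    and w: "w \<in> U" "\<sigma> w = exp (- (of_real s * a)) * c"
    and u: "a * \<sigma> w = w * u * deriv \<sigma> w"
  shows "((\<lambda>s. g (exp (- (of_real s * a)) * c)) has_vector_derivative - (w * u)) (at s within S)"
proof -
  obtain k where k: "k holomorphic_on \<sigma> ` U" "\<And>z. z \<in> U \<Longrightarrow> deriv \<sigma> z * deriv k (\<sigma> z) = 1" "\<And>z. z \<in> U \<Longrightarrow> k (\<sigma> z) = z"
    using holomorphic_has_inverse[OF hol U inj] by metis
  have op: "open (\<sigma> ` U)" by (rule open_mapping_thm3[OF hol U inj])
  have mem: "\<sigma> w \<in> \<sigma> ` U" using w(1) by blast
  then have "(k has_field_derivative deriv k (\<sigma> w)) (at (\<sigma> w))"
    by (rule holomorphic_derivI[OF k(1) op])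
  then have "(g has_field_derivative deriv k (\<sigma> w)) (at (\<sigma> w))"
    by (rule has_field_derivative_transform_within_open[OF _ op mem]) (use g k in auto)
  then have g': "(g has_field_derivative deriv k (\<sigma> w)) (at (exp (- (of_real s * a)) * c) within (\<lambda>s. exp (- (of_real s * a)) * c) ` S)"
    unfolding w(2) by (rule has_field_derivative_at_within)
  have "((g \<circ> (\<lambda>s. exp (- (of_real s * a)) * c)) has_vector_derivative
     (- a * (exp (- (of_real s * a)) * c)) * deriv k (\<sigma> w)) (at s within S)"
    by (rule field_vector_diff_chain_within[OF deriv_exp_line g'])
  also have "(- a * (exp (- (of_real s * a)) * c)) * deriv k (\<sigma> w) = - (w * u) * (deriv \<sigma> w * deriv k (\<sigma> w))"
    unfolding w(2)[symmetric] mult_minus_left mult.assoc[symmetric] u by (simp add: mult_ac)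
  also have "\<dots> = - (w * u)" using k(2)[OF w(1)] by simp
  finally show ?thesis by (simp add: o_def)
qed

text \<open>The sign of \<open>Re u\<close> governs the growth of the modulus along the flow; both
  directions of the theorem use this.\<close>

lemma norm_square_derivative:
  fixes c :: "real \<Rightarrow> complex"
  assumes "(c has_vector_derivative - (w * u)) (at s within S)" "c s = w"
  shows "((\<lambda>s. (norm (c s))\<^sup>2) has_real_derivative (- 2 * (norm w)\<^sup>2 * Re u)) (at s within S)"
proof -
  have "((\<lambda>s. c s \<bullet> c s) has_derivative (\<lambda>h. c s \<bullet> (h *\<^sub>R - (w * u)) + (h *\<^sub>R - (w * u)) \<bullet> c s)) (at s within S)"
    using assms(1) unfolding has_vector_derivative_def by (intro has_derivative_inner)
  moreover have "(\<lambda>h. c s \<bullet> (h *\<^sub>R - (w * u)) + (h *\<^sub>R - (w * u)) \<bullet> c s) = (*) (- 2 * (norm w)\<^sup>2 * Re u)"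
    unfolding assms(2) cmod_power2
    by (auto simp: inner_complex_def algebra_simps power2_eq_square)
  ultimately show ?thesis
    by (simp add: has_field_derivative_def power2_norm_eq_inner)
qed

text \<open>The condition \<open>u\<close> says that \<open>z * u z = a * \<sigma> z / \<sigma>' z\<close> is the vector field that \<open>\<sigma>\<close> linearizes.\<close>
locale spirallike =
  fixes \<sigma> u :: "complex \<Rightarrow> complex" and a :: complex
  assumes hol: "\<sigma> holomorphic_on unit_disc" and hol_u: "u holomorphic_on unit_disc"
    and \<sigma>0: "\<sigma> 0 = 0" and nz: "\<And>z. norm z < 1 \<Longrightarrow> deriv \<sigma> z \<noteq> 0"
    and u: "\<And>z. norm z < 1 \<Longrightarrow> a * \<sigma> z = z * u z * deriv \<sigma> z"
    and Re_u: "\<And>z. norm z < 1 \<Longrightarrow> Re (u z) \<ge> 0"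
    and u0: "u 0 = a" and Re_a: "Re a > 0"
begin

text \<open>As \<open>Re u \<ge> 0\<close>, a zero of \<open>u\<close> would maximize the modulus of
  \<open>exp (- u w)\<close>, making it constant with modulus \<open>1\<close>, against
  \<open>Re (u 0) > 0\<close>.\<close>

lemma u_nonzero:
  assumes z: "norm z < 1" shows "u z \<noteq> 0"
proof
  assume 0: "u z = 0"
  have "(\<lambda>w. exp (- u w)) constant_on unit_disc"
  proof (rule maximum_modulus_principle[where U = unit_disc and \<xi> = z])
    show "norm (exp (- u w)) \<le> norm (exp (- u z))" if "w \<in> unit_disc" for w
      using that Re_u 0 by simp
  qed (use z in \<open>auto intro!: holomorphic_intros hol_u\<close>)
  then have "exp (- u 0) = exp (- u z)"
    using z unfolding constant_on_def by (metis centre_in_ball mem_ball_0 zero_less_one)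
  then have "norm (exp (- u 0)) = 1" using 0 by simp
  then show False using Re_a u0 by simp
qed

lemma \<sigma>_eq_0_iff:
  assumes "norm z < 1" shows "\<sigma> z = 0 \<longleftrightarrow> z = 0"
proof
  assume "\<sigma> z = 0"
  then show "z = 0" using u[OF assms] u_nonzero[OF assms] nz[OF assms] by simp
qed (simp add: \<sigma>0)

text \<open>With \<open>m\<close> the minimum of \<open>norm (deriv \<sigma> w)\<close> on a
  slightly larger disc, uniform continuity keeps the derivative within \<open>m / 2\<close> of its
  value at the centre. So \<open>\<sigma>\<close> is a perturbation of a linear map too small to
  destroy injectivity, and Bloch's lemma gives image discs of common radius.\<close>

lemma uniformly_locally_bijective:
  assumes R: "0 < R" "R < 1"
  obtains \<epsilon> \<eta> where "\<epsilon> > 0" "\<eta> > 0" "R + \<epsilon> < 1"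
    "\<And>z. norm z \<le> R \<Longrightarrow> inj_on \<sigma> (ball z \<epsilon>)"
    "\<And>z. norm z \<le> R \<Longrightarrow> ball (\<sigma> z) \<eta> \<subseteq> \<sigma> ` ball z (\<epsilon> / 2)"
proof -
  define R' where "R' = (1 + R) / 2"
  have R': "R < R'" "R' < 1" using R by (auto simp: R'_def)
  have sub: "cball 0 R' \<subseteq> unit_disc" using R' by auto
  have cd: "continuous_on (cball 0 R') (deriv \<sigma>)"
    by (rule holomorphic_on_imp_continuous_on[OF holomorphic_on_subset[OF holomorphic_deriv[OF hol open_ball] sub]])
  have "continuous_on (cball 0 R') (\<lambda>w. norm (deriv \<sigma> w))" by (intro continuous_intros cd)
  then obtain w0 where w0: "w0 \<in> cball 0 R'" "\<And>w. w \<in> cball 0 R' \<Longrightarrow> norm (deriv \<sigma> w0) \<le> norm (deriv \<sigma> w)"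
    using continuous_attains_inf[OF compact_cball, of 0 R' "\<lambda>w. norm (deriv \<sigma> w)"] R R' by auto
  define m where "m = norm (deriv \<sigma> w0)"
  have m: "m > 0" using nz[of w0] w0(1) R' by (auto simp: m_def)
  have "uniformly_continuous_on (cball 0 R') (deriv \<sigma>)"
    by (rule compact_uniformly_continuous[OF cd compact_cball])
  then obtain d where d: "d > 0" "\<And>x y. x \<in> cball 0 R' \<Longrightarrow> y \<in> cball 0 R' \<Longrightarrow> dist y x < d \<Longrightarrow> dist (deriv \<sigma> y) (deriv \<sigma> x) < m / 2"
    unfolding uniformly_continuous_on_def using m by (meson half_gt_zero)
  define \<epsilon> where "\<epsilon> = min d (R' - R)"
  have \<epsilon>: "\<epsilon> > 0" "R + \<epsilon> < 1" using d R' by (auto simp: \<epsilon>_def)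
  have sub': "ball z \<epsilon> \<subseteq> cball 0 R'" if "norm z \<le> R" for z
  proof
    fix x assume "x \<in> ball z \<epsilon>"
    then have "norm (x - z) < R' - R" by (simp add: \<epsilon>_def dist_norm norm_minus_commute)
    then show "x \<in> cball 0 R'" using that norm_triangle_ineq2[of x z] by simp
  qed
  have near: "norm (deriv \<sigma> x - deriv \<sigma> z) \<le> m / 2" if "norm z \<le> R" "x \<in> ball z \<epsilon>" for x z
  proof -
    have "x \<in> cball 0 R'" using sub'[OF that(1)] that(2) by blast
    moreover have "dist x z < d" using that(2) by (simp add: \<epsilon>_def dist_commute)
    ultimately have "dist (deriv \<sigma> x) (deriv \<sigma> z) < m / 2" using that(1) R' by (intro d(2)) auto
    then show ?thesis by (simp add: dist_norm)
  qed
  have big: "m \<le> norm (deriv \<sigma> z)" if "norm z \<le> R" for z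
    unfolding m_def using that R' by (intro w0) auto
  \<comment> \<open>The radius from Bloch's lemma for a disc of radius
    \<open>\<epsilon> / 2\<close>, with the derivative replaced by its lower bound \<open>m\<close>;
    it is positive because \<open>sqrt 2 < 3 / 2\<close>.\<close>
  have pos: "(3 - 2 * sqrt 2) * (\<epsilon> / 2) * m > 0"
  proof -
    have "sqrt 2 < sqrt ((3/2)^2)" by (intro real_sqrt_less_mono) (simp add: power2_eq_square)
    then show ?thesis using \<epsilon> m by simp
  qed
  show ?thesis
  proof (rule that[OF \<epsilon>(1) pos \<epsilon>(2)])
    fix z :: complex assume z: "norm z \<le> R"
    show "inj_on \<sigma> (ball z \<epsilon>)"
    proof (rule inj_onI)
      fix x y assume xy: "x \<in> ball z \<epsilon>" "y \<in> ball z \<epsilon>" "\<sigma> x = \<sigma> y"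
      have "norm ((\<sigma> x - deriv \<sigma> z * x) - (\<sigma> y - deriv \<sigma> z * y)) \<le> m / 2 * norm (x - y)"
      proof (rule field_differentiable_bound[where f' = "\<lambda>w. deriv \<sigma> w - deriv \<sigma> z" and S = "ball z \<epsilon>"])
        fix w assume w: "w \<in> ball z \<epsilon>"
        then have "w \<in> unit_disc" using sub'[OF z] sub by blast
        then have "(\<sigma> has_field_derivative deriv \<sigma> w) (at w within ball z \<epsilon>)"
          by (rule holomorphic_derivI[OF hol open_ball, THEN has_field_derivative_at_within])
        then show "((\<lambda>w. \<sigma> w - deriv \<sigma> z * w) has_field_derivative deriv \<sigma> w - deriv \<sigma> z) (at w within ball z \<epsilon>)"
          by (auto intro!: derivative_eq_intros)
        show "norm (deriv \<sigma> w - deriv \<sigma> z) \<le> m / 2" by (rule near[OF z w])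
      qed (use xy in auto)
      also have "(\<sigma> x - deriv \<sigma> z * x) - (\<sigma> y - deriv \<sigma> z * y) = deriv \<sigma> z * (y - x)"
        using xy(3) by (simp add: algebra_simps)
      finally have "norm (deriv \<sigma> z) * norm (x - y) \<le> m / 2 * norm (x - y)"
        by (simp add: norm_mult norm_minus_commute)
      moreover have "m * norm (x - y) \<le> norm (deriv \<sigma> z) * norm (x - y)"
        using big[OF z] by (rule mult_right_mono) simp
      ultimately have "m * norm (x - y) \<le> 0" by simp
      then show "x = y" using m by (simp add: mult_le_0_iff)
    qed
    have "cball z (\<epsilon> / 2) \<subseteq> ball z \<epsilon>" using \<epsilon> by (auto simp: subset_eq)
    then have sub2: "cball z (\<epsilon> / 2) \<subseteq> unit_disc" using sub'[OF z] sub by blast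
    have "ball (\<sigma> z) ((3 - 2 * sqrt 2) * (\<epsilon> / 2) * norm (deriv \<sigma> z)) \<subseteq> \<sigma> ` ball z (\<epsilon> / 2)"
    proof (rule Bloch_lemma)
      fix w assume "w \<in> ball z (\<epsilon> / 2)"
      then have "w \<in> ball z \<epsilon>" using \<epsilon> by auto
      from near[OF z this] big[OF z] norm_triangle_ineq2[of "deriv \<sigma> w" "deriv \<sigma> z"] m
      show "norm (deriv \<sigma> w) \<le> 2 * norm (deriv \<sigma> z)" by linarith
    qed (use \<epsilon> holomorphic_on_subset[OF hol sub2] in auto)
    moreover have "(3 - 2 * sqrt 2) * (\<epsilon> / 2) * m \<le> (3 - 2 * sqrt 2) * (\<epsilon> / 2) * norm (deriv \<sigma> z)"
      using big[OF z] pos m \<epsilon>(1) by (intro mult_left_mono) (auto simp: zero_less_mult_iff)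
    ultimately show "ball (\<sigma> z) ((3 - 2 * sqrt 2) * (\<epsilon> / 2) * m) \<subseteq> \<sigma> ` ball z (\<epsilon> / 2)"
      using subset_ball by blast
  qed
qed

text \<open>One \<open>\<delta>\<close> serves the whole disc because \<open>\<eta>\<close> does and
  \<open>\<sigma>\<close> is bounded there. A step moves each point by less than
  \<open>\<epsilon> / 2\<close>, so two points with a common image lie in one ball on which
  \<open>\<sigma>\<close> is injective. This is the last clause, which later lets orbits be traced
  backwards before global injectivity is known.\<close>

lemma local_flow:
  assumes R: "0 < R" "R < 1"
  obtains \<delta> where "\<delta> > 0" "\<And>s. 0 \<le> s \<Longrightarrow> s \<le> \<delta> \<Longrightarrow>
    \<exists>f. (\<forall>z. norm z \<le> R \<longrightarrow> norm (f z) \<le> norm z \<and> \<sigma> (f z) = exp (- (of_real s * a)) * \<sigma> z) \<and>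
        (\<forall>y z. norm y \<le> R \<longrightarrow> norm z \<le> R \<longrightarrow> \<sigma> y = \<sigma> z \<longrightarrow> f y = f z \<longrightarrow> y = z)"
proof -
  obtain \<epsilon> \<eta> where \<epsilon>: "\<epsilon> > 0" "\<eta> > 0" "R + \<epsilon> < 1"
    and inj: "\<And>z. norm z \<le> R \<Longrightarrow> inj_on \<sigma> (ball z \<epsilon>)"
    and surj: "\<And>z. norm z \<le> R \<Longrightarrow> ball (\<sigma> z) \<eta> \<subseteq> \<sigma> ` ball z (\<epsilon> / 2)"
    using uniformly_locally_bijective[OF R] by blast
  have "continuous_on (cball 0 R) \<sigma>"
    using R by (intro holomorphic_on_imp_continuous_on holomorphic_on_subset[OF hol]) auto
  then have "bounded (\<sigma> ` cball 0 R)"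
    by (intro compact_imp_bounded compact_continuous_image compact_cball)
  then obtain B where B: "B > 0" "\<And>z. norm z \<le> R \<Longrightarrow> norm (\<sigma> z) \<le> B"
    unfolding bounded_pos by force
  have "((\<lambda>s. exp (- (of_real s * a))) \<longlongrightarrow> exp (- (of_real 0 * a))) (at (0::real))"
    by (intro tendsto_intros)
  then have "\<forall>\<^sub>F s in at (0::real). dist (exp (- (of_real s * a))) (exp (- (of_real 0 * a))) < \<eta> / B"
    using \<epsilon> B by (intro tendstoD) auto
  then obtain \<delta> where \<delta>: "\<delta> > 0" "\<And>s::real. s \<noteq> 0 \<Longrightarrow> dist s 0 < \<delta> \<Longrightarrow> norm (exp (- (of_real s * a)) - 1) < \<eta> / B"
    unfolding eventually_at by (auto simp: dist_norm)
  have close: "exp (- (of_real s * a)) * \<sigma> z \<in> ball (\<sigma> z) \<eta>" if "0 \<le> s" "s \<le> \<delta> / 2" "norm z \<le> R" for s z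
  proof -
    have "norm (exp (- (of_real s * a)) - 1) < \<eta> / B"
      using \<delta>(2)[of s] that \<delta>(1) \<epsilon> B by (cases "s = 0") auto
    then have "norm (exp (- (of_real s * a)) - 1) * B < \<eta>"
      using B(1) by (simp add: pos_less_divide_eq)
    moreover have "norm (exp (- (of_real s * a)) - 1) * norm (\<sigma> z) \<le> norm (exp (- (of_real s * a)) - 1) * B"
      using B(2)[OF that(3)] by (rule mult_left_mono) simp
    ultimately have "norm (exp (- (of_real s * a)) - 1) * norm (\<sigma> z) < \<eta>" by linarith
    then have "norm ((exp (- (of_real s * a)) - 1) * \<sigma> z) < \<eta>" by (simp add: norm_mult)
    then show ?thesis by (simp add: dist_norm norm_minus_commute algebra_simps)
  qed
  show ?thesis
  \<comment> \<open>Halving turns the open time interval from \<open>eventually_at\<close> into a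
    closed one.\<close>
  proof (rule that[of "\<delta> / 2"])
    fix s assume s: "0 \<le> s" "s \<le> \<delta> / 2"
    have ex: "\<exists>w. w \<in> ball z (\<epsilon> / 2) \<and> \<sigma> w = exp (- (of_real s * a)) * \<sigma> z \<and> norm w \<le> norm z" if z: "norm z \<le> R" for z
    proof -
      define g where "g = the_inv_into (ball z \<epsilon>) \<sigma>"
      have g: "g (\<sigma> w) = w" if "w \<in> ball z \<epsilon>" for w
        unfolding g_def by (rule the_inv_into_f_f[OF inj[OF z] that])
      \<comment> \<open>The lift of the spiral that starts at \<open>z\<close>. It stays in the ball
        up to time \<open>s\<close>, so its squared modulus is differentiable and nonincreasing
        there.\<close>
      define c where "c \<tau> = g (exp (- (of_real \<tau> * a)) * \<sigma> z)" for \<tau>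
      have c: "c \<tau> \<in> ball z (\<epsilon> / 2)" "\<sigma> (c \<tau>) = exp (- (of_real \<tau> * a)) * \<sigma> z" if \<tau>: "0 \<le> \<tau>" "\<tau> \<le> s" for \<tau>
      proof -
        have "exp (- (of_real \<tau> * a)) * \<sigma> z \<in> \<sigma> ` ball z (\<epsilon> / 2)"
          using close[of \<tau> z] surj[OF z] \<tau> s z by auto
        then obtain w where w: "w \<in> ball z (\<epsilon> / 2)" "exp (- (of_real \<tau> * a)) * \<sigma> z = \<sigma> w" by blast
        then have "c \<tau> = w" unfolding c_def using g[of w] \<epsilon> by auto
        then show "c \<tau> \<in> ball z (\<epsilon> / 2)" "\<sigma> (c \<tau>) = exp (- (of_real \<tau> * a)) * \<sigma> z" using w by auto
      qed
      have sub: "norm w < 1" if "w \<in> ball z \<epsilon>" for w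
        using that z \<epsilon> norm_triangle_ineq2[of w z] by (simp add: dist_norm norm_minus_commute)
      have D: "((\<lambda>\<tau>. (norm (c \<tau>))\<^sup>2) has_real_derivative (- 2 * (norm (c \<tau>))\<^sup>2 * Re (u (c \<tau>)))) (at \<tau>)"
        if \<tau>: "0 \<le> \<tau>" "\<tau> \<le> s" for \<tau>
      proof (rule norm_square_derivative[OF _ refl])
        have cb: "c \<tau> \<in> ball z \<epsilon>" using c(1)[OF \<tau>] \<epsilon> by auto
        have "((\<lambda>\<tau>. g (exp (- (of_real \<tau> * a)) * \<sigma> z)) has_vector_derivative - (c \<tau> * u (c \<tau>))) (at \<tau>)"
        proof (rule inverse_curve_derivative[where U = "ball z \<epsilon>" and \<sigma> = \<sigma>])
          show "\<sigma> holomorphic_on ball z \<epsilon>"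
            by (rule holomorphic_on_subset[OF hol]) (use sub in auto)
          show "a * \<sigma> (c \<tau>) = c \<tau> * u (c \<tau>) * deriv \<sigma> (c \<tau>)" by (rule u[OF sub[OF cb]])
        qed (use inj[OF z] g cb c(2)[OF \<tau>] in simp_all)
        then show "(c has_vector_derivative - (c \<tau> * u (c \<tau>))) (at \<tau>)"
          by (simp only: c_def[abs_def])
      qed
      have "(norm (c s))\<^sup>2 \<le> (norm (c 0))\<^sup>2"
      proof (rule DERIV_nonpos_imp_nonincreasing[OF s(1)])
        fix \<tau> assume \<tau>: "0 \<le> \<tau>" "\<tau> \<le> s"
        have "norm (c \<tau>) < 1" using sub c(1)[OF \<tau>] \<epsilon> by auto
        then have "- 2 * (norm (c \<tau>))\<^sup>2 * Re (u (c \<tau>)) \<le> 0"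
          using Re_u by (simp add: mult_le_0_iff zero_le_mult_iff)
        then show "\<exists>y. ((\<lambda>\<tau>. (norm (c \<tau>))\<^sup>2) has_real_derivative y) (at \<tau>) \<and> y \<le> 0"
          using D[OF \<tau>] by blast
      qed
      moreover have "c 0 = z" unfolding c_def using g[of z] \<epsilon> by simp
      ultimately have "norm (c s) \<le> norm z" by (simp add: power2_le_iff_abs_le)
      then show ?thesis using c[of s] s by auto
    qed
    define f where "f z = (SOME w. w \<in> ball z (\<epsilon> / 2) \<and> \<sigma> w = exp (- (of_real s * a)) * \<sigma> z \<and> norm w \<le> norm z)" for z
    have f: "f z \<in> ball z (\<epsilon> / 2)" "\<sigma> (f z) = exp (- (of_real s * a)) * \<sigma> z" "norm (f z) \<le> norm z" if "norm z \<le> R" for z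
      using someI_ex[OF ex[OF that], folded f_def] by auto
    have "y = z" if yz: "norm y \<le> R" "norm z \<le> R" "\<sigma> y = \<sigma> z" "f y = f z" for y z
    proof (rule inj_onD[OF inj[OF yz(2)] yz(3)])
      have "dist y z \<le> dist y (f y) + dist z (f z)"
        using yz(4) by (metis dist_commute dist_triangle)
      then have "dist y z < \<epsilon>" using f(1)[OF yz(1)] f(1)[OF yz(2)] by simp
      then show "y \<in> ball z \<epsilon>" by (simp add: dist_commute)
    qed (use \<epsilon> in simp)
    then show "\<exists>f. (\<forall>z. norm z \<le> R \<longrightarrow> norm (f z) \<le> norm z \<and> \<sigma> (f z) = exp (- (of_real s * a)) * \<sigma> z) \<and>
        (\<forall>y z. norm y \<le> R \<longrightarrow> norm z \<le> R \<longrightarrow> \<sigma> y = \<sigma> z \<longrightarrow> f y = f z \<longrightarrow> y = z)"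
      using f by blast
  qed (use \<delta> in simp)
qed

lemma iterate_flow:
  assumes "\<And>z. norm z \<le> R \<Longrightarrow> norm (f z) \<le> norm z \<and> \<sigma> (f z) = exp (- (of_real s * a)) * \<sigma> z"
    and "norm z \<le> R"
  shows "norm ((f ^^ n) z) \<le> norm z \<and> \<sigma> ((f ^^ n) z) = exp (- (of_real (real n * s) * a)) * \<sigma> z"
proof (induction n)
  case (Suc n)
  then have "norm ((f ^^ n) z) \<le> R" using assms(2) by simp
  from assms(1)[OF this] have "norm ((f ^^ Suc n) z) \<le> norm z"
    and "\<sigma> ((f ^^ Suc n) z) = exp (- (of_real (s + real n * s) * a)) * \<sigma> z"
    using Suc by (simp_all only: exp_rate_add mult.assoc funpow.simps o_apply) (meson order.trans)
  then show ?case by (simp add: distrib_right)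
qed simp

text \<open>The range of \<open>\<sigma>\<close> is spirallike: any time is split into equal parts
  of length at most \<open>\<delta>\<close>, and one step map on the disc of radius \<open>R\<close>
  is iterated.\<close>

lemma flow_exists:
  assumes s: "s \<ge> 0" and z: "norm z < 1"
  shows "\<exists>w. norm w < 1 \<and> \<sigma> w = exp (- (of_real s * a)) * \<sigma> z"
proof -
  define R where "R = (1 + norm z) / 2"
  have R: "0 < R" "R < 1" "norm z \<le> R" using z by (auto simp: R_def intro: add_pos_nonneg)
  obtain \<delta> where \<delta>: "\<delta> > 0" "\<And>s. 0 \<le> s \<Longrightarrow> s \<le> \<delta> \<Longrightarrow>
    \<exists>f. (\<forall>z. norm z \<le> R \<longrightarrow> norm (f z) \<le> norm z \<and> \<sigma> (f z) = exp (- (of_real s * a)) * \<sigma> z) \<and>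
        (\<forall>y z. norm y \<le> R \<longrightarrow> norm z \<le> R \<longrightarrow> \<sigma> y = \<sigma> z \<longrightarrow> f y = f z \<longrightarrow> y = z)"
    using local_flow[OF R(1,2)] by metis
  obtain n :: nat where n: "s / \<delta> < real n" using reals_Archimedean2 by blast
  then have n0: "n > 0" using s \<delta>(1) by (cases n) (auto simp: field_simps)
  have "0 \<le> s / real n" "s / real n \<le> \<delta>" using s n n0 \<delta>(1) by (auto simp: field_simps)
  from \<delta>(2)[OF this] obtain f where
    "\<And>z. norm z \<le> R \<Longrightarrow> norm (f z) \<le> norm z \<and> \<sigma> (f z) = exp (- (of_real (s / real n) * a)) * \<sigma> z"
    by metis
  from iterate_flow[OF this R(3), of n] n0 z show ?thesis
    by (intro exI[of _ "(f ^^ n) z"]) (auto simp del: of_real_divide)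
qed

text \<open>Two points with the same image are moved by an injective step \<open>f\<close> of the flow into a small
  disc around \<open>0\<close>, where \<open>\<sigma>\<close> is injective.\<close>
lemma inj_\<sigma>: "inj_on \<sigma> unit_disc"
proof (rule inj_onI)
  fix y z assume yz: "y \<in> unit_disc" "z \<in> unit_disc" "\<sigma> y = \<sigma> z"
  define R where "R = (1 + max (norm y) (norm z)) / 2"
  have R: "0 < R" "R < 1" "norm y \<le> R" "norm z \<le> R"
    using yz norm_ge_zero[of y] norm_ge_zero[of z] by (auto simp: R_def max_def add_pos_nonneg)
  obtain \<epsilon> \<eta> where \<epsilon>: "\<epsilon> > 0" and inj: "\<And>z. norm z \<le> R \<Longrightarrow> inj_on \<sigma> (ball z \<epsilon>)"
    using uniformly_locally_bijective[OF R(1,2)] by metis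
  obtain \<delta> where \<delta>: "\<delta> > 0" "\<And>s. 0 \<le> s \<Longrightarrow> s \<le> \<delta> \<Longrightarrow>
    \<exists>f. (\<forall>z. norm z \<le> R \<longrightarrow> norm (f z) \<le> norm z \<and> \<sigma> (f z) = exp (- (of_real s * a)) * \<sigma> z) \<and>
        (\<forall>y z. norm y \<le> R \<longrightarrow> norm z \<le> R \<longrightarrow> \<sigma> y = \<sigma> z \<longrightarrow> f y = f z \<longrightarrow> y = z)"
    using local_flow[OF R(1,2)] by metis
  obtain f where f: "\<And>z. norm z \<le> R \<Longrightarrow> norm (f z) \<le> norm z \<and> \<sigma> (f z) = exp (- (of_real \<delta> * a)) * \<sigma> z"
    and f_inj: "\<And>y z. norm y \<le> R \<Longrightarrow> norm z \<le> R \<Longrightarrow> \<sigma> y = \<sigma> z \<Longrightarrow> f y = f z \<Longrightarrow> y = z"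
    using \<delta>(2)[of \<delta>] \<delta>(1) by auto
  have lim: "\<forall>\<^sub>F n in sequentially. (f ^^ n) x \<in> ball 0 \<epsilon>" if x: "norm x \<le> R" for x
  proof (cases "cball 0 R - ball 0 \<epsilon> = ({} :: complex set)")
    case True
    have "(f ^^ n) x \<in> cball 0 R" for n using iterate_flow[OF f x, of n] x by auto
    then show ?thesis using True by (intro always_eventually) blast
  next
    case False
    \<comment> \<open>On this ring \<open>norm (\<sigma> w)\<close> has a positive minimum, since
      \<open>\<sigma>\<close> vanishes only at \<open>0\<close>. Along the orbit
      \<open>norm (\<sigma> x)\<close> decays geometrically as \<open>Re a > 0\<close>, so the
      orbit, confined to the disc of radius \<open>R\<close>, must leave the ring.\<close>
    have "continuous_on (cball 0 R - ball 0 \<epsilon>) (\<lambda>w. norm (\<sigma> w))"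
      using R by (intro continuous_intros holomorphic_on_imp_continuous_on holomorphic_on_subset[OF hol]) auto
    moreover have "compact (cball (0::complex) R - ball 0 \<epsilon>)" by (intro compact_diff) auto
    ultimately obtain w where w: "w \<in> cball 0 R - ball 0 \<epsilon>" "\<And>v. v \<in> cball 0 R - ball 0 \<epsilon> \<Longrightarrow> norm (\<sigma> w) \<le> norm (\<sigma> v)"
      using continuous_attains_inf[OF _ False, of "\<lambda>w. norm (\<sigma> w)"] by blast
    have wpos: "norm (\<sigma> w) > 0" using w(1) \<epsilon> R \<sigma>_eq_0_iff[of w] by auto
    have "(\<lambda>n. exp (- (\<delta> * Re a)) ^ n * norm (\<sigma> x)) \<longlonglongrightarrow> 0 * norm (\<sigma> x)"
      using \<delta>(1) Re_a by (intro tendsto_intros LIMSEQ_power_zero) simp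
    then have "\<forall>\<^sub>F n in sequentially. exp (- (\<delta> * Re a)) ^ n * norm (\<sigma> x) < norm (\<sigma> w)"
      using wpos by (intro order_tendstoD(2)) auto
    then show ?thesis
    proof (rule eventually_mono)
      fix n assume n: "exp (- (\<delta> * Re a)) ^ n * norm (\<sigma> x) < norm (\<sigma> w)"
      have it: "norm ((f ^^ n) x) \<le> norm x" "\<sigma> ((f ^^ n) x) = exp (- (of_real (real n * \<delta>) * a)) * \<sigma> x"
        using iterate_flow[OF f x, of n] by auto
      have "norm (\<sigma> ((f ^^ n) x)) = exp (- (\<delta> * Re a)) ^ n * norm (\<sigma> x)"
        unfolding it(2) by (simp add: norm_mult exp_of_nat_mult[symmetric] mult.assoc)
      with n w(2)[of "(f ^^ n) x"] it(1) x show "(f ^^ n) x \<in> ball 0 \<epsilon>" by force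
    qed
  qed
  have "\<forall>\<^sub>F n in sequentially. (f ^^ n) y \<in> ball 0 \<epsilon> \<and> (f ^^ n) z \<in> ball 0 \<epsilon>"
    using lim[OF R(3)] lim[OF R(4)] by (rule eventually_conj)
  then obtain n where n: "(f ^^ n) y \<in> ball 0 \<epsilon>" "(f ^^ n) z \<in> ball 0 \<epsilon>"
    unfolding eventually_sequentially by blast
  have \<sigma>n: "\<sigma> ((f ^^ k) y) = \<sigma> ((f ^^ k) z)" for k
    using iterate_flow[OF f R(3), of k] iterate_flow[OF f R(4), of k] yz(3) by simp
  have "(f ^^ n) y = (f ^^ n) z"
    using inj_onD[OF inj[of 0] \<sigma>n n] R by simp
  \<comment> \<open>Backwards along the orbits: at each stage the values of \<open>\<sigma>\<close>
    agree, so equal images under \<open>f\<close> come from equal points.\<close>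
  then show "y = z"
  proof (induction n)
    case (Suc n)
    have "norm ((f ^^ n) y) \<le> R" "norm ((f ^^ n) z) \<le> R"
      using iterate_flow[OF f R(3), of n] iterate_flow[OF f R(4), of n] R by auto
    then have "(f ^^ n) y = (f ^^ n) z" using f_inj \<sigma>n Suc.prems by simp
    then show ?case by (rule Suc.IH)
  qed simp
qed

section \<open>The global flow\<close>

definition flow :: "real \<Rightarrow> complex \<Rightarrow> complex" where
  "flow s z = the_inv_into unit_disc \<sigma> (exp (- (of_real s * a)) * \<sigma> z)"

lemma flow:
  assumes "s \<ge> 0" "norm z < 1"
  shows "norm (flow s z) < 1" "\<sigma> (flow s z) = exp (- (of_real s * a)) * \<sigma> z"
proof -
  obtain w where w: "norm w < 1" "\<sigma> w = exp (- (of_real s * a)) * \<sigma> z"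
    using flow_exists[OF assms] by blast
  then have "flow s z = w"
    unfolding flow_def w(2)[symmetric] by (intro the_inv_into_f_f inj_\<sigma>) auto
  then show "norm (flow s z) < 1" "\<sigma> (flow s z) = exp (- (of_real s * a)) * \<sigma> z" using w by auto
qed

lemma flow_eqI:
  assumes "norm w < 1" "\<sigma> w = exp (- (of_real s * a)) * \<sigma> z"
  shows "flow s z = w"
  unfolding flow_def assms(2)[symmetric] by (intro the_inv_into_f_f inj_\<sigma>) (use assms in auto)

lemma flow_0: "norm z < 1 \<Longrightarrow> flow 0 z = z"
  by (rule flow_eqI) auto

lemma flow_at_0: "flow s 0 = 0"
  by (rule flow_eqI) (auto simp: \<sigma>0)

lemma flow_add:
  assumes "s \<ge> 0" "t \<ge> 0" "norm z < 1"
  shows "flow (s + t) z = flow s (flow t z)"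
  by (rule flow_eqI) (simp_all only: flow assms exp_rate_add mult.assoc)

lemma inverse_holomorphic: "the_inv_into unit_disc \<sigma> holomorphic_on \<sigma> ` unit_disc"
proof -
  obtain g where g: "g holomorphic_on \<sigma> ` unit_disc" "\<And>z. z \<in> unit_disc \<Longrightarrow> g (\<sigma> z) = z"
    using holomorphic_has_inverse[OF hol open_ball inj_\<sigma>] by metis
  then show ?thesis
    by (elim holomorphic_transform) (auto simp: the_inv_into_f_f[OF inj_\<sigma>])
qed

lemma in_range:
  assumes "s \<ge> 0" "norm z < 1"
  shows "exp (- (of_real s * a)) * \<sigma> z \<in> \<sigma> ` unit_disc"
  using flow_exists[OF assms] by force

lemma flow_holomorphic:
  assumes "s \<ge> 0" shows "flow s holomorphic_on unit_disc"
proof -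
  have "(the_inv_into unit_disc \<sigma> \<circ> (\<lambda>z. exp (- (of_real s * a)) * \<sigma> z)) holomorphic_on unit_disc"
    by (rule holomorphic_on_compose_gen[OF _ inverse_holomorphic])
       (use in_range[OF assms] in \<open>auto intro!: holomorphic_intros hol\<close>)
  then show ?thesis by (simp add: o_def flow_def[abs_def])
qed

lemma flow_continuous:
  assumes "norm z < 1" shows "continuous_on {0..} (\<lambda>s. flow s z)"
  unfolding flow_def
  by (rule continuous_on_compose2[OF holomorphic_on_imp_continuous_on[OF inverse_holomorphic]])
     (use in_range assms in \<open>auto intro!: continuous_intros\<close>)

end

section \<open>Embeddability\<close>

context spirallike
begin

text \<open>Each flow map fixes \<open>0\<close> and is therefore a K-transform. Its continuity in
  time at fixed \<open>z\<close> gives weak continuity through the moments, and injectivity of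
  \<open>\<sigma>\<close> identifies the K-transform of \<mu> with the flow at time
  \<open>t0\<close>.\<close>

lemma flow_embeddable:
  assumes \<mu>: "circle_prob \<mu>" and t0: "t0 \<ge> 0"
    and K: "\<And>z. norm z < 1 \<Longrightarrow> \<sigma> (K_transform \<mu> z) = exp (- (of_real t0 * a)) * \<sigma> z"
  shows "embeddable \<mu>"
proof -
  have "\<exists>\<rho>. circle_prob \<rho> \<and> (\<forall>z\<in>unit_disc. K_transform \<rho> z = flow s z)" if "s \<ge> 0" for s
    using K_transform_surj[OF flow_holomorphic[OF that] flow_at_0 flow(1)[OF that]] by metis
  then obtain M where M: "\<And>s. s \<ge> 0 \<Longrightarrow> circle_prob (M s)"
    "\<And>s z. s \<ge> 0 \<Longrightarrow> norm z < 1 \<Longrightarrow> K_transform (M s) z = flow s z"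
    by (metis mem_ball_0)
  have "monotone_conv_semigroup M"
    unfolding monotone_conv_semigroup_def
  proof (intro conjI allI impI)
    show "weakly_continuous_family M"
      unfolding weakly_continuous_family_def
    proof (intro allI impI)
      fix f :: "complex \<Rightarrow> real" assume f: "continuous_on unit_circle f"
      have "continuous_on {0..} (\<lambda>s. K_transform (M s) z)" if "z \<in> unit_disc" for z
        by (rule continuous_on_eq[OF flow_continuous[of z]]) (use that M in auto)
      then show "continuous_on {0..} (\<lambda>t. \<integral>x. f x \<partial>M t)"
        using M by (intro continuous_on_circle_integral continuous_on_circle_moment f) auto
    qed
    show "M 0 = return circle_borel 1"
      using M by (intro K_transform_inject circle_prob_return) (auto simp: K_transform_return flow_0)
    show "M s \<rhd> M t = M (s + t)" if "0 \<le> s" "0 \<le> t" for s t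
      using that M flow(1) by (intro monotone_conv_eqI) (auto simp: flow_add)
  qed (use M in auto)
  moreover have "\<mu> = M t0"
  proof (rule K_transform_inject[OF \<mu> M(1)[OF t0]])
    fix z :: complex assume "z \<in> unit_disc"
    then have z: "norm z < 1" by simp
    show "K_transform \<mu> z = K_transform (M t0) z"
      unfolding M(2)[OF t0 z]
      using flow_eqI[OF K_transform_maps_disc[OF \<mu> z] K[OF z]] by simp
  qed
  ultimately show ?thesis using t0 unfolding embeddable_def by blast
qed

end

lemma embeddable_imp_generator:
  assumes \<mu>: "circle_prob \<mu>" and nondeg: "\<not> (\<exists>\<xi>\<in>unit_circle. measure \<mu> {\<xi>} = 1)"
    and emb: "embeddable \<mu>"
  shows "(\<forall>z\<in>unit_disc. deriv (K_transform \<mu>) z \<noteq> 0) \<and>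
    (\<exists>v. locally_uniform_limit unit_disc
           (\<lambda>n z. - ((K_transform \<mu> ^^ n) z / deriv (K_transform \<mu> ^^ n) z)) v \<and>
         (\<exists>(\<alpha>::complex) u. \<alpha> \<noteq> 0 \<and> u holomorphic_on unit_disc \<and>
            (\<forall>z\<in>unit_disc. v z = \<alpha> * z * u z) \<and>
            (\<forall>z\<in>unit_disc. Re (u z) \<ge> 0) \<and>
            (\<exists>t0::real. t0 \<ge> 0 \<and>
               deriv (K_transform \<mu>) 0 = exp (- (complex_of_real t0 * u 0)))))"
proof -
  obtain M t where M: "monotone_conv_semigroup M" and t: "t \<ge> 0" "\<mu> = M t"
    using emb unfolding embeddable_def by blast
  interpret S: K_semigroup M by unfold_locales fact
  obtain a where a: "\<And>s. s \<ge> 0 \<Longrightarrow> deriv (K_transform (M s)) 0 = exp (- (of_real s * a))"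
    using S.obtain_rate by blast
  have lt1: "norm (exp (- (of_real t * a))) < 1"
    using norm_deriv_K_transform_less_1[OF \<mu> nondeg] a[OF t(1)] t(2) by simp
  have a0: "a \<noteq> 0" using lt1 by auto
  \<comment> \<open>Schwarz' lemma at time \<open>1\<close> gives
    \<open>norm (exp (- a)) \<le> 1\<close>.\<close>
  have Re_a: "Re a \<ge> 0"
    using Schwarz_Lemma(2)[OF S.hol K_transform_0 S.maps, of 1 0] a[of 1] by simp
  interpret koenigs "K_transform \<mu>" "exp (- (of_real t * a))"
    using holomorphic_K_transform[OF \<mu>] K_transform_maps_disc[OF \<mu>] a[OF t(1)] t(2) lt1
    by unfold_locales auto
  have nz: "deriv (K_transform \<mu>) z \<noteq> 0" if "norm z < 1" for z
    unfolding t(2) by (rule S.deriv_K_nz[OF t(1) that])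
  have \<sigma>nz: "deriv \<sigma> z \<noteq> 0" if "norm z < 1" for z
    using deriv_\<sigma>_nz nz that by blast
  have generator: "locally_uniform_limit unit_disc
      (\<lambda>n z. - ((K_transform \<mu> ^^ n) z / deriv (K_transform \<mu> ^^ n) z)) (\<lambda>z. - (\<sigma> z / deriv \<sigma> z))"
    by (rule locally_uniform_limit_generator) (rule nz)
  have \<sigma>_flow: "\<sigma> (K_transform (M s) z) = exp (- (of_real s * a)) * \<sigma> z" if s: "s \<ge> 0" and z: "norm z < 1" for s z
  proof -
    have "\<sigma> (K_transform (M s) z) = deriv (K_transform (M s)) 0 * \<sigma> z"
    proof (rule \<sigma>_commute[OF S.hol[OF s] K_transform_0 S.maps[OF s] _ z])
      fix z :: complex assume "norm z < 1"
      then show "K_transform (M s) (K_transform \<mu> z) = K_transform \<mu> (K_transform (M s) z)"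
        unfolding t(2) using s t(1) S.K_add[of s t z] S.K_add[of t s z] by (simp add: add.commute)
    qed
    then show ?thesis using a[OF s] by simp
  qed
  \<comment> \<open>This is \<open>a * \<sigma> z / (z * deriv \<sigma> z)\<close> with the factor
    \<open>z\<close> cancelled by \<open>\<sigma> z = z * P z\<close>, so \<open>0\<close> is no
    exceptional point.\<close>
  define u where "u z = a * P z / deriv \<sigma> z" for z
  have hol_u: "u holomorphic_on unit_disc"
    unfolding u_def[abs_def] using \<sigma>nz hol_P hol_\<sigma> by (intro holomorphic_intros) auto
  have u0: "u 0 = a" by (simp add: u_def P_0 deriv_\<sigma>_0)
  have u_eq: "a * \<sigma> z = z * u z * deriv \<sigma> z" if "norm z < 1" for z
    using \<sigma>nz[OF that] by (simp add: u_def \<sigma>_def)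
  have Re_u: "Re (u z) \<ge> 0" if z: "norm z < 1" for z
  proof (cases "z = 0")
    case True
    then show ?thesis using Re_a u0 by simp
  next
    case z0: False
    obtain r where r: "r > 0" "ball z r \<subseteq> unit_disc" "inj_on \<sigma> (ball z r)"
      using has_complex_derivative_locally_injective[OF hol_\<sigma> _ open_ball \<sigma>nz[OF z]] z by auto
    define g where "g = the_inv_into (ball z r) \<sigma>"
    have g: "g (\<sigma> w) = w" if "w \<in> ball z r" for w
      unfolding g_def by (rule the_inv_into_f_f[OF r(3) that])
    \<comment> \<open>A local lift of the spiral with known derivative at \<open>0\<close>. For
      small \<open>s \<ge> 0\<close> it coincides with \<open>K_transform (M s) z\<close>: by
      continuity this point lies in the ball where \<open>\<sigma>\<close> is injective, and
      \<open>\<sigma>\<close> has the same value. An initial increase of the modulus would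
      contradict \<open>norm_K_le\<close>.\<close>
    define c where "c s = g (exp (- (of_real s * a)) * \<sigma> z)" for s
    have c0: "c 0 = z" unfolding c_def using g[of z] r(1) by simp
    have "((\<lambda>s. g (exp (- (of_real s * a)) * \<sigma> z)) has_vector_derivative - (z * u z)) (at 0)"
      by (rule inverse_curve_derivative[where U = "ball z r" and \<sigma> = \<sigma>])
         (use r g u_eq[OF z] holomorphic_on_subset[OF hol_\<sigma> r(2)] in auto)
    then have "(c has_vector_derivative - (z * u z)) (at 0)"
      by (simp only: c_def[abs_def])
    from norm_square_derivative[OF this c0]
    have D: "((\<lambda>s. (norm (c s))\<^sup>2) has_real_derivative - 2 * (norm z)\<^sup>2 * Re (u z)) (at 0)" .
    show ?thesis
    proof (rule ccontr)
      assume "\<not> Re (u z) \<ge> 0"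
      then have "- 2 * (norm z)\<^sup>2 * Re (u z) > 0" using z0 by (simp add: mult_less_0_iff)
      from DERIV_pos_inc_right[OF D this] obtain d where
        d: "d > 0" "\<And>h. h > 0 \<Longrightarrow> h < d \<Longrightarrow> (norm (c 0))\<^sup>2 < (norm (c (0 + h)))\<^sup>2" by blast
      have "((\<lambda>s. K_transform (M s) z) \<longlongrightarrow> K_transform (M 0) z) (at 0 within {0..})"
        using S.continuous_K[OF z] unfolding continuous_on_def by (metis atLeast_iff order_refl)
      moreover have "K_transform (M 0) z = z" using S.M_0 z by (simp add: K_transform_return)
      ultimately have "\<forall>\<^sub>F s in at 0 within {0..}. dist (K_transform (M s) z) z < r"
        using r(1) by (metis tendstoD)
      then obtain d' where d': "d' > 0" "\<And>s. s \<in> {0..} \<Longrightarrow> s \<noteq> 0 \<Longrightarrow> dist s 0 < d' \<Longrightarrow> dist (K_transform (M s) z) z < r"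
        unfolding eventually_at by blast
      define s where "s = min d d' / 2"
      have s: "s > 0" "s < d" "s < d'" using d(1) d'(1) by (auto simp: s_def)
      have "K_transform (M s) z \<in> ball z r"
        using d'(2)[of s] s by (simp add: dist_commute)
      then have "c s = K_transform (M s) z"
        unfolding c_def using g \<sigma>_flow[OF less_imp_le[OF s(1)] z] by metis
      then have "norm (c s) \<le> norm (c 0)"
        using S.norm_K_le[of s z] s(1) z c0 by simp
      then have "(norm (c s))\<^sup>2 \<le> (norm (c 0))\<^sup>2" by (rule power_mono) simp
      with d(2)[OF s(1,2)] show False unfolding add_0 by linarith
    qed
  qed
  have v: "- (\<sigma> z / deriv \<sigma> z) = - 1 / a * z * u z" for z
    using a0 by (simp add: u_def \<sigma>_def)
  have rate: "deriv (K_transform \<mu>) 0 = exp (- (complex_of_real t * u 0))"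
    using a[OF t(1)] t(2) u0 by simp
  show ?thesis
  proof (rule conjI, use nz in simp, rule exI[of _ "\<lambda>z. - (\<sigma> z / deriv \<sigma> z)"], rule conjI[OF generator],
      rule exI[of _ "- 1 / a"], rule exI[of _ u], intro conjI ballI exI[of _ t])
    show "- (\<sigma> z / deriv \<sigma> z) = - 1 / a * z * u z" for z by (rule v)
  qed (use a0 hol_u Re_u t(1) rate in auto)
qed

lemma generator_imp_embeddable:
  assumes \<mu>: "circle_prob \<mu>" and nondeg: "\<not> (\<exists>\<xi>\<in>unit_circle. measure \<mu> {\<xi>} = 1)"
    and nz: "\<And>z. norm z < 1 \<Longrightarrow> deriv (K_transform \<mu>) z \<noteq> 0"
    and lim: "locally_uniform_limit unit_disc
           (\<lambda>n z. - ((K_transform \<mu> ^^ n) z / deriv (K_transform \<mu> ^^ n) z)) v"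
    and hol_u: "u holomorphic_on unit_disc"
    and v: "\<And>z. norm z < 1 \<Longrightarrow> v z = \<alpha> * z * u z"
    and Re_u: "\<And>z. norm z < 1 \<Longrightarrow> Re (u z) \<ge> 0"
    and t0: "t0 \<ge> 0" "deriv (K_transform \<mu>) 0 = exp (- (complex_of_real t0 * u 0))"
  shows "embeddable \<mu>"
proof -
  have lt1: "norm (deriv (K_transform \<mu>) 0) < 1"
    by (rule norm_deriv_K_transform_less_1[OF \<mu> nondeg])
  \<comment> \<open>As the measure is not concentrated in one point, the derivative at
    \<open>0\<close> has modulus strictly below \<open>1\<close>; this makes both factors
    positive.\<close>
  have "t0 * Re (u 0) > 0" using lt1 unfolding t0(2) by simp
  then have Re_u0: "Re (u 0) > 0" using t0(1) by (simp add: zero_less_mult_iff)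
  interpret koenigs "K_transform \<mu>" "deriv (K_transform \<mu>) 0"
    using holomorphic_K_transform[OF \<mu>] K_transform_maps_disc[OF \<mu>] lt1 t0(2)
    by unfold_locales auto
  have \<sigma>nz: "deriv \<sigma> z \<noteq> 0" if "norm z < 1" for z
    using deriv_\<sigma>_nz nz that by blast
  have generator: "locally_uniform_limit unit_disc
      (\<lambda>n z. - ((K_transform \<mu> ^^ n) z / deriv (K_transform \<mu> ^^ n) z)) (\<lambda>z. - (\<sigma> z / deriv \<sigma> z))"
    by (rule locally_uniform_limit_generator) (rule nz)
  have ptw: "(\<lambda>n. f n z) \<longlonglongrightarrow> l z" if "locally_uniform_limit unit_disc f l" "norm z < 1" for f l and z :: complex
  proof -
    obtain r where r: "r > 0" "uniform_limit (ball z r) f l sequentially"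
      using \<open>locally_uniform_limit unit_disc f l\<close> \<open>norm z < 1\<close> unfolding locally_uniform_limit_def by force
    then show ?thesis by (intro tendsto_uniform_limitI[OF r(2)]) simp
  qed
  have v_eq: "\<alpha> * z * u z = - (\<sigma> z / deriv \<sigma> z)" if z: "norm z < 1" for z
    using LIMSEQ_unique[OF ptw[OF lim z] ptw[OF generator z]] v[OF z] by simp
  have P_eq: "P z = - \<alpha> * u z * deriv \<sigma> z" if "norm z < 1" "z \<noteq> 0" for z
  proof -
    have "z * P z = z * (- \<alpha> * u z * deriv \<sigma> z)"
      using v_eq[OF that(1)] \<sigma>nz[OF that(1)] by (simp add: \<sigma>_def field_simps)
    then show ?thesis using that(2) by (metis mult_cancel_left)
  qed
  \<comment> \<open>At \<open>0\<close> the factor \<open>z\<close> cannot be cancelled, so the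
    identity is extended there by continuity. With \<open>P 0 = 1\<close> and
    \<open>deriv \<sigma> 0 = 1\<close> it fixes \<open>\<alpha> * u 0\<close>.\<close>
  have "P 0 = - \<alpha> * u 0 * deriv \<sigma> 0"
  proof -
    have cont: "isCont f 0" if "f holomorphic_on unit_disc" for f
      using holomorphic_on_imp_continuous_on[OF that] continuous_on_eq_continuous_at[OF open_ball, of "0::complex" 1 f] by auto
    have "isCont P 0" and "isCont (\<lambda>z. - \<alpha> * u z * deriv \<sigma> z) 0"
      by (intro cont hol_P, intro cont holomorphic_intros hol_u hol_\<sigma>) auto
    then have lim: "(P \<longlongrightarrow> P 0) (at 0)" "((\<lambda>z. - \<alpha> * u z * deriv \<sigma> z) \<longlongrightarrow> - \<alpha> * u 0 * deriv \<sigma> 0) (at 0)"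
      by (simp_all only: isCont_def)
    have "\<forall>\<^sub>F z in at 0. P z = - \<alpha> * u z * deriv \<sigma> z"
      unfolding eventually_at by (rule exI[of _ 1]) (use P_eq in auto)
    with lim(1) have "((\<lambda>z. - \<alpha> * u z * deriv \<sigma> z) \<longlongrightarrow> P 0) (at 0)"
      by (rule Lim_transform_eventually)
    then show ?thesis using lim(2) by (rule tendsto_unique[OF at_neq_bot])
  qed
  then have \<alpha>u0: "\<alpha> * u 0 = - 1" by (simp add: P_0 deriv_\<sigma>_0 minus_equation_iff)
  \<comment> \<open>Multiplying \<open>\<sigma> z = - \<alpha> * z * u z * deriv \<sigma> z\<close>
    by \<open>u 0\<close> removes the unknown constant, because
    \<open>- (\<alpha> * u 0) = 1\<close>; so \<open>u 0\<close> is the rate of the flow.\<close>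
  interpret spirallike \<sigma> u "u 0"
  proof unfold_locales
    fix z :: complex assume z: "norm z < 1"
    have "\<sigma> z = - \<alpha> * z * u z * deriv \<sigma> z"
      using v_eq[OF z] \<sigma>nz[OF z] by (simp add: field_simps)
    then have "u 0 * \<sigma> z = - (\<alpha> * u 0) * z * u z * deriv \<sigma> z" by simp
    then show "u 0 * \<sigma> z = z * u z * deriv \<sigma> z" by (simp add: \<alpha>u0)
  qed (use hol_\<sigma> hol_u \<sigma>nz Re_u Re_u0 in auto)
  show ?thesis
  proof (rule flow_embeddable[OF \<mu> t0(1)])
    fix z :: complex assume "norm z < 1"
    from \<sigma>_K[OF this] show "\<sigma> (K_transform \<mu> z) = exp (- (of_real t0 * u 0)) * \<sigma> z"
      by (rule trans) (simp only: t0(2)[symmetric])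
  qed
qed

theorem theorem8p3:
  fixes \<mu> :: "complex measure"
  assumes "circle_prob \<mu>"
    and "\<not> (\<exists>\<xi>\<in>unit_circle. measure \<mu> {\<xi>} = 1)"
  shows "embeddable \<mu> \<longleftrightarrow>
    (\<forall>z\<in>unit_disc. deriv (K_transform \<mu>) z \<noteq> 0) \<and>
    (\<exists>v. locally_uniform_limit unit_disc
           (\<lambda>n z. - ((K_transform \<mu> ^^ n) z / deriv (K_transform \<mu> ^^ n) z)) v \<and>
         (\<exists>(\<alpha>::complex) u. \<alpha> \<noteq> 0 \<and> u holomorphic_on unit_disc \<and>
            (\<forall>z\<in>unit_disc. v z = \<alpha> * z * u z) \<and>
            (\<forall>z\<in>unit_disc. Re (u z) \<ge> 0) \<and>
            (\<exists>t0::real. t0 \<ge> 0 \<and>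
               deriv (K_transform \<mu>) 0 = exp (- (complex_of_real t0 * u 0)))))"
  (is "_ \<longleftrightarrow> ?nonzero \<and> ?generator")
proof
  assume "?nonzero \<and> ?generator"
  then show "embeddable \<mu>"
    using generator_imp_embeddable[OF assms] by (auto simp: Ball_def)
qed (rule embeddable_imp_generator[OF assms])

end
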